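(* Let $\kappa>0$ and let $q:[0,\infty)\to[0,\infty)$ be a penalty function, with $q_\lambda(t)=\lambda^2q(t/\lambda)$ for $t\ge0$, satisfying: (i) $q$ is non-decreasing on $[0,\infty)$ with $q(0)=0$; (ii) $q$ is differentiable almost everywhere on $(0,\infty)$, $0\le q'(t)\le1$ and $\lim_{t\downarrow0}q'(t)=1$; (iii) $q'(t_1)\le q'(t_2)$ for all $t_1\ge t_2\ge0$. Assume there exists a constant $\alpha_0>0$ such that $$\frac{\alpha_0}{\sqrt{1+\{q'(\alpha_0)/2\}^2}}>\frac1{\kappa\gamma_p}\quad\text{and}\quad q'(\alpha_0)>0.$$ Let the penalty level $\lambda>0$ and bandwidth $h>0$ satisfy $b_h^*\le(s/\gamma_p)^{1/2}\lambda$. Define $r_{\rm opt}=\gamma_p^{1/2}\alpha_0c\,s^{1/2}\lambda$ and $l=\{(2+\frac2{q'(\alpha_0)})(c^2+1)^{1/2}+\frac2{q'(\alpha_0)}\}(s/\gamma_p)^{1/2}$, where $c>0$ is defined through the equation $$0.5\,q'(\alpha_0)(c^2+1)^{1/2}+2=\alpha_0\kappa\gamma_p\,c.$$ Then, for any $r\ge r_{\rm opt}$, conditioned on the event $\mathcal E_{\rm rsc}(r,l,\kappa)\cap\{\|w_h^*\|_\infty\le0.5\,q'(\alpha_0)\lambda\}$, the sequence of solutions $\{\hat\beta^{(\ell)}\}_{\ell\ge1}$ of the iteratively reweighted programs, initialized at $\hat\beta^{(0)}=0$, satisfies $$\|\hat\beta^{(\ell)}-\beta^*\|_\Sigma\le\delta\cdot\|\hat\beta^{(\ell-1)}-\beta^*\|_\Sigma+r_{\rm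 ora}+\kappa^{-1}b_h^*,$$ where $$r_{\rm ora}:=\kappa^{-1}\gamma_p^{-1/2}\big\{\|q_\lambda'((|\beta^*_{\mathcal S}|-\alpha_0\lambda)_+)\|_2+\|w^*_{h,\mathcal S}\|_2\big\},\qquad\delta=\frac{\sqrt{1+\{q'(\alpha_0)/2\}^2}}{\alpha_0\kappa\gamma_p}\in(0,1).$$ In addition, $$\|\hat\beta^{(\ell)}-\beta^*\|_\Sigma\le\delta^{\ell-1}r_{\rm opt}+(1-\delta)^{-1}\big(r_{\rm ora}+\kappa^{-1}b_h^*\big)\quad\text{for any }\ell\ge2.$$
   Context: Model. Fix $\tau\in(0,1)$. $x=(x_1,\dots,x_p)^T$ is a random vector with $x_1\equiv1$, $y=x^T\beta^*+\varepsilon$ with $P(\varepsilon\le0\mid x)=\tau$; $(y_i,x_i)_{i=1}^n$ are i.i.d. copies. $\mathcal S=\{j:\beta_j^*\neq0\}$, $s=|\mathcal S|$. $\Sigma=E(xx^T)$ is positive definite with smallest eigenvalue $\gamma_p\in(0,1]$; $\|u\|_\Sigma=\|\Sigma^{1/2}u\|_2$. For a vector $u$, $u_{\mathcal S}$ is the subvector indexed by $\mathcal S$; functions of vectors ($|\cdot|$, $(\cdot)_+=\max(\cdot,0)$, $q_\lambda'$) act entrywise. Smoothed loss. $\rho_\tau(u)=u\{\tau-1(u<0)\}$; $K:\mathbb{R}\to[0,\infty)$ is a symmetric kernel integrating to one, $K_h(u)=h^{-1}K(u/h)$, $\bar K(u)=\int_{-\infty}^uK$, $\ell_h(u)=\int\rho_\tau(v)K_h(v-u)\,dv$,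 $\hat Q_h(\beta)=\frac1n\sum_i\ell_h(y_i-x_i^T\beta)$, with gradient $\nabla\hat Q_h(\beta)=\frac1n\sum_i\{\bar K((x_i^T\beta-y_i)/h)-\tau\}x_i$, and $Q_h(\beta)=E\{\hat Q_h(\beta)\}$. Put $w_h^*=\nabla\hat Q_h(\beta^* )-\nabla Q_h(\beta^* )$, $w^*_{h,\mathcal S}=(w_h^* )_{\mathcal S}$, $b_h^*=\|\Sigma^{-1/2}\nabla Q_h(\beta^* )\|_2$. Penalty. $q_\lambda(t)=\lambda^2q(t/\lambda)$ for $t\ge0$, where $q:[0,\infty)\to[0,\infty)$ satisfies: (i) $q$ is non-decreasing with $q(0)=0$; (ii) $q$ is differentiable almost everywhere on $(0,\infty)$, $0\le q'(t)\le1$ and $\lim_{t\downarrow0}q'(t)=1$; (iii) $q'(t_1)\le q'(t_2)$ for all $t_1\ge t_2\ge0$. Here $q'$ denotes a fixed non-increasing version of the derivative, with $q'(0)=1$; $q_\lambda'(t)=\lambda q'(t/\lambda)$, so $q_\lambda'(0)=\lambda$. Iterates. $\hat\beta^{(0)}=0$, and for $\ell\ge1$, $\hat\beta^{(\ell)}\in\arg\min_{\beta}\{\hat Q_h(\beta)+\sum_{j=1}^pq_\lambda'(|\hat\beta_j^{(\ell-1)}|)|\beta_j|\}$. Local restricted strong convexity. For $r,l,\kappa>0$, $\mathcal E_{\rm rsc}(r,l,\kappa)$ is the event that $\langle\nabla\hat Q_h(\beta)-\nabla\hat Q_h(\beta^* ),\beta-\beta^*\rangle\ge\kappa\|\beta-\beta^*\|_\Sigma^2$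 for all $\beta$ with $\|\beta-\beta^*\|_\Sigma\le r$ and $\|\beta-\beta^*\|_1\le l\|\beta-\beta^*\|_\Sigma$. *)

theory Defs
  imports "HOL-Probability.Probability"
begin

section \<open>Linear algebra\<close>

definition norm1 :: "real^'p \<Rightarrow> real" where
  "norm1 u = (\<Sum>j\<in>UNIV. \<bar>u $ j\<bar>)"

definition pos_semidef :: "real^'p^'p \<Rightarrow> bool" where
  "pos_semidef A \<longleftrightarrow> transpose A = A \<and> (\<forall>v. v \<bullet> (A *v v) \<ge> 0)"

definition pos_def :: "real^'p^'p \<Rightarrow> bool" where
  "pos_def A \<longleftrightarrow> transpose A = A \<and> (\<forall>v. v \<noteq> 0 \<longrightarrow> v \<bullet> (A *v v) > 0)"

definition is_eigenvalue :: "real^'p^'p \<Rightarrow> real \<Rightarrow> bool" where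
  "is_eigenvalue A \<mu> \<longleftrightarrow> (\<exists>v. v \<noteq> 0 \<and> A *v v = \<mu> *\<^sub>R v)"

definition min_eigenvalue :: "real^'p^'p \<Rightarrow> real" where
  "min_eigenvalue A = (LEAST \<mu>. is_eigenvalue A \<mu>)"

(* A positive semidefinite A has exactly one positive semidefinite square root. *)
definition matrix_sqrt :: "real^'p^'p \<Rightarrow> real^'p^'p" where
  "matrix_sqrt A = (SOME B. pos_semidef B \<and> B ** B = A)"

definition norm_wrt :: "real^'p^'p \<Rightarrow> real^'p \<Rightarrow> real" where
  "norm_wrt A u = norm (matrix_sqrt A *v u)"

(* Unspecified where f is not differentiable. *)
definition gradient :: "('v::real_inner \<Rightarrow> real) \<Rightarrow> 'v \<Rightarrow> 'v" where
  "gradient f x = (THE D. GDERIV f x :> D)"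


section \<open>Quantile regression model\<close>

definition second_moment :: "'a measure \<Rightarrow> ('a \<Rightarrow> real^'p) \<Rightarrow> real^'p^'p" where
  "second_moment M x = (\<chi> j k. \<integral>\<omega>. x \<omega> $ j * x \<omega> $ k \<partial>M)"

(* x, y, eps: generic covariate vector, response and error; X i, Y i (i < n): the sample;
   one: index of the intercept coordinate.  The integrability clause says that
   Sigma = E(x x^T) exists. *)
definition quantile_model ::
  "'a measure \<Rightarrow> real \<Rightarrow> 'p::finite \<Rightarrow> real^'p \<Rightarrow> ('a \<Rightarrow> real^'p) \<Rightarrow> ('a \<Rightarrow> real) \<Rightarrow> ('a \<Rightarrow> real)
    \<Rightarrow> nat \<Rightarrow> (nat \<Rightarrow> 'a \<Rightarrow> real^'p) \<Rightarrow> (nat \<Rightarrow> 'a \<Rightarrow> real) \<Rightarrow> bool" where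
  "quantile_model M \<tau> one \<beta>s x y eps n X Y \<longleftrightarrow>
     prob_space M \<and> 0 < \<tau> \<and> \<tau> < 1 \<and> 0 < n \<and>
     x \<in> borel_measurable M \<and> eps \<in> borel_measurable M \<and>
     (\<forall>\<omega>\<in>space M. x \<omega> $ one = 1) \<and>
     (\<forall>\<omega>\<in>space M. y \<omega> = x \<omega> \<bullet> \<beta>s + eps \<omega>) \<and>
     (AE \<omega> in M. real_cond_exp M (vimage_algebra (space M) x borel)
                    (\<lambda>\<omega>'. indicator {..0} (eps \<omega>')) \<omega> = \<tau>) \<and>
     (\<forall>j k. integrable M (\<lambda>\<omega>. x \<omega> $ j * x \<omega> $ k)) \<and>
     prob_space.indep_vars M (\<lambda>_. borel) (\<lambda>i \<omega>. (Y i \<omega>, X i \<omega>)) {..<n} \<and>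
     (\<forall>i<n. distr M borel (\<lambda>\<omega>. (Y i \<omega>, X i \<omega>)) = distr M borel (\<lambda>\<omega>. (y \<omega>, x \<omega>)))"


section \<open>Smoothed loss\<close>

definition check_loss :: "real \<Rightarrow> real \<Rightarrow> real" where
  "check_loss \<tau> u = u * (\<tau> - (if u < 0 then 1 else 0))"

definition scaled_kernel :: "(real \<Rightarrow> real) \<Rightarrow> real \<Rightarrow> real \<Rightarrow> real" where
  "scaled_kernel K h u = K (u / h) / h"

definition smoothing_kernel :: "(real \<Rightarrow> real) \<Rightarrow> bool" where
  "smoothing_kernel K \<longleftrightarrow>
     (\<forall>u. 0 \<le> K u) \<and> (\<forall>u. K (- u) = K u) \<and> has_bochner_integral lborel K 1"

definition smoothed_loss :: "real \<Rightarrow> (real \<Rightarrow> real) \<Rightarrow> real \<Rightarrow> real \<Rightarrow> real" where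
  "smoothed_loss \<tau> K h u = (\<integral>v. check_loss \<tau> v * scaled_kernel K h (v - u) \<partial>lborel)"

(* The integral defining l_h(u) is finite; it is infinite for every u as soon as
   |u| K(u) fails to be integrable. *)
definition smoothed_loss_finite :: "real \<Rightarrow> (real \<Rightarrow> real) \<Rightarrow> real \<Rightarrow> bool" where
  "smoothed_loss_finite \<tau> K h \<longleftrightarrow>
     (\<forall>u. integrable lborel (\<lambda>v. check_loss \<tau> v * scaled_kernel K h (v - u)))"

definition emp_loss ::
  "real \<Rightarrow> (real \<Rightarrow> real) \<Rightarrow> real \<Rightarrow> nat \<Rightarrow> (nat \<Rightarrow> real^'p) \<Rightarrow> (nat \<Rightarrow> real) \<Rightarrow> real^'p \<Rightarrow> real" where
  "emp_loss \<tau> K h n xs ys \<beta> = (\<Sum>i<n. smoothed_loss \<tau> K h (ys i - xs i \<bullet> \<beta>)) / real n"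

definition kernel_cdf :: "(real \<Rightarrow> real) \<Rightarrow> real \<Rightarrow> real" where
  "kernel_cdf K u = (LINT t:{..u}|lborel. K t)"

lemma gradient_eqI: assumes "GDERIV f x :> D" shows "gradient f x = D"
  unfolding gradient_def
proof (rule the_equality)
  show "GDERIV f x :> D" by fact
next
  fix D' assume "GDERIV f x :> D'"
  with assms have "(\<lambda>d. d \<bullet> D') = (\<lambda>d. d \<bullet> D)"
    unfolding gderiv_def by (rule has_derivative_unique[rotated])
  then have "d \<bullet> D' = d \<bullet> D" for d by meson
  then show "D' = D" by (metis inner_commute vector_eq_rdot)
qed

lemma smoothed_loss_deriv:
  assumes "0 < \<tau>" "\<tau> < 1" "0 < h" and K: "smoothing_kernel K" and fin: "smoothed_loss_finite \<tau> K h"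
  shows "(smoothed_loss \<tau> K h has_real_derivative \<tau> - kernel_cdf K (- u / h)) (at u)"
proof -
  let ?k = "scaled_kernel K h" and ?\<rho> = "check_loss \<tau>"
  have K0: "K t \<ge> 0" for t using K by (simp add: smoothing_kernel_def)
  have hbK: "has_bochner_integral lborel K 1" using K by (simp add: smoothing_kernel_def)
  have intK: "integrable lborel K" using hbK by (rule integrable.intros)
  have [measurable]: "K \<in> borel_measurable borel" using borel_measurable_integrable[OF intK] by simp
  have [measurable]: "?\<rho> \<in> borel_measurable borel" "?k \<in> borel_measurable borel"
    unfolding check_loss_def scaled_kernel_def by measurable
  have k0: "?k t \<ge> 0" for t using K0 \<open>0 < h\<close> by (simp add: scaled_kernel_def)
  have intk: "integrable lborel ?k"
    using lborel_integrable_real_affine[OF intK, of "1/h" 0] \<open>0 < h\<close> by (simp add: scaled_kernel_def[abs_def])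
  have K1: "(\<integral>t. ?k t \<partial>lborel) = 1"
    using lborel_integral_real_affine[of "1/h" K 0] hbK \<open>0 < h\<close>
    by (simp add: scaled_kernel_def[abs_def] has_bochner_integral_iff)
  have shift: "integrable lborel (\<lambda>t. ?\<rho> (v + t) * ?k t)"
    "smoothed_loss \<tau> K h v = (\<integral>t. ?\<rho> (v + t) * ?k t \<partial>lborel)" for v
  proof -
    have "integrable lborel (\<lambda>t. ?\<rho> t * ?k (t - v))" using fin by (simp add: smoothed_loss_finite_def)
    from lborel_integrable_real_affine[OF this, of 1 v]
    show "integrable lborel (\<lambda>t. ?\<rho> (v + t) * ?k t)" by simp
    show "smoothed_loss \<tau> K h v = (\<integral>t. ?\<rho> (v + t) * ?k t \<partial>lborel)"
      unfolding smoothed_loss_def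
      using lborel_integral_real_affine[of 1 "\<lambda>t. ?\<rho> t * ?k (t - v)" v] by simp
  qed
  have rho: "?\<rho> a = max (\<tau> * a) ((\<tau> - 1) * a)" for a
    using assms by (auto simp: check_loss_def max_def algebra_simps mult_le_0_iff not_less)
  have lip: "\<bar>?\<rho> a - ?\<rho> b\<bar> \<le> \<bar>a - b\<bar>" for a b
  proof -
    have *: "\<bar>t * a - t * b\<bar> \<le> \<bar>a - b\<bar>" if "\<bar>t\<bar> \<le> 1" for t
    proof -
      have "\<bar>t * a - t * b\<bar> = \<bar>t\<bar> * \<bar>a - b\<bar>" by (simp flip: abs_mult add: algebra_simps)
      also have "\<dots> \<le> 1 * \<bar>a - b\<bar>" using that by (intro mult_right_mono) auto
      finally show ?thesis by simp
    qed
    have "\<bar>\<tau>\<bar> \<le> 1" "\<bar>\<tau> - 1\<bar> \<le> 1" using assms by auto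
    from this[THEN *] show ?thesis unfolding rho by linarith
  qed
  define D where "D t = (if t < - u then \<tau> - 1 else \<tau>)" for t :: real
  have D_lim: "((\<lambda>d. (?\<rho> (u + d + t) - ?\<rho> (u + t)) / d) \<longlongrightarrow> D t) (at 0)" if "t \<noteq> - u" for t
  proof -
    have "(?\<rho> has_real_derivative D t) (at (u + t))"
    proof (cases "t < - u")
      case True
      have "((\<lambda>a. a * (\<tau> - 1)) has_real_derivative D t) (at (u + t))"
        using True by (auto intro!: derivative_eq_intros simp: D_def)
      moreover have "\<forall>\<^sub>F a in nhds (u + t). ?\<rho> a = a * (\<tau> - 1)"
        using eventually_nhds_in_open[of "{..<0}" "u + t"] True
        by (auto elim!: eventually_mono simp: check_loss_def)
      ultimately show ?thesis by (subst DERIV_cong_ev[OF refl _ refl])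
    next
      case False
      have "((\<lambda>a. a * \<tau>) has_real_derivative D t) (at (u + t))"
        using False by (auto intro!: derivative_eq_intros simp: D_def)
      moreover have "\<forall>\<^sub>F a in nhds (u + t). ?\<rho> a = a * \<tau>"
        using eventually_nhds_in_open[of "{0<..}" "u + t"] False that
        by (auto elim!: eventually_mono simp: check_loss_def)
      ultimately show ?thesis by (subst DERIV_cong_ev[OF refl _ refl])
    qed
    then show ?thesis by (simp add: DERIV_def add_ac)
  qed
  have "((\<lambda>d. (smoothed_loss \<tau> K h (u + d) - smoothed_loss \<tau> K h u) / d)
      \<longlongrightarrow> (\<integral>t. D t * ?k t \<partial>lborel)) (at 0)"
    unfolding tendsto_at_iff_sequentially comp_def
  proof (intro allI impI)
    fix d :: "nat \<Rightarrow> real" assume d: "\<forall>i. d i \<in> UNIV - {0}" "d \<longlonglongrightarrow> 0"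
    have [measurable]: "D \<in> borel_measurable borel" unfolding D_def[abs_def] by measurable
    have "(\<lambda>i. \<integral>t. (?\<rho> (u + d i + t) - ?\<rho> (u + t)) / d i * ?k t \<partial>lborel) \<longlonglongrightarrow> (\<integral>t. D t * ?k t \<partial>lborel)"
    proof (rule integral_dominated_convergence[where w = ?k])
      show "AE t in lborel. (\<lambda>i. (?\<rho> (u + d i + t) - ?\<rho> (u + t)) / d i * ?k t) \<longlonglongrightarrow> D t * ?k t"
        using AE_lborel_singleton[of "- u"]
      proof eventually_elim
        case (elim t)
        have "filterlim d (at 0) sequentially" using d by (auto simp: filterlim_at)
        from filterlim_compose[OF D_lim[OF elim] this] show ?case by (intro tendsto_intros)
      qed
      show "AE t in lborel. norm ((?\<rho> (u + d i + t) - ?\<rho> (u + t)) / d i * ?k t) \<le> ?k t" for i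
      proof (rule AE_I2)
        fix t
        have "\<bar>(?\<rho> (u + d i + t) - ?\<rho> (u + t)) / d i\<bar> \<le> 1"
          using lip[of "u + d i + t" "u + t"] d(1) by (simp add: abs_divide divide_le_eq_1)
        from mult_right_mono[OF this k0[of t]] k0[of t]
        show "norm ((?\<rho> (u + d i + t) - ?\<rho> (u + t)) / d i * ?k t) \<le> ?k t" by (simp add: abs_mult)
      qed
    qed (use intk in measurable)
    moreover have "(\<integral>t. (?\<rho> (u + d i + t) - ?\<rho> (u + t)) / d i * ?k t \<partial>lborel)
        = (smoothed_loss \<tau> K h (u + d i) - smoothed_loss \<tau> K h u) / d i" for i
    proof -
      have "(\<integral>t. (?\<rho> (u + d i + t) - ?\<rho> (u + t)) / d i * ?k t \<partial>lborel)
        = (\<integral>t. (?\<rho> (u + d i + t) * ?k t - ?\<rho> (u + t) * ?k t) / d i \<partial>lborel)"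
        by (simp add: field_simps)
      also have "\<dots> = (smoothed_loss \<tau> K h (u + d i) - smoothed_loss \<tau> K h u) / d i"
        unfolding shift(2) using shift(1)[of "u + d i"] shift(1)[of u] by (simp add: add.assoc)
      finally show ?thesis .
    qed
    ultimately show "(\<lambda>i. (smoothed_loss \<tau> K h (u + d i) - smoothed_loss \<tau> K h u) / d i)
        \<longlonglongrightarrow> (\<integral>t. D t * ?k t \<partial>lborel)" by (simp only:)
  qed
  moreover have "(\<integral>t. D t * ?k t \<partial>lborel) = \<tau> - kernel_cdf K (- u / h)"
  proof -
    have int: "integrable lborel (\<lambda>t. indicator {..-u} t * ?k t)"
      using integrable_mult_indicator[OF _ intk, of "{..-u}"] by simp
    have "(\<integral>t. D t * ?k t \<partial>lborel) = (\<integral>t. \<tau> * ?k t - indicator {..-u} t * ?k t \<partial>lborel)"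
    proof (rule integral_cong_AE)
      show "AE t in lborel. D t * ?k t = \<tau> * ?k t - indicator {..-u} t * ?k t"
        using AE_lborel_singleton[of "- u"] by eventually_elim (auto simp: D_def indicator_def algebra_simps)
    qed (auto simp: D_def[abs_def])
    also have "\<dots> = \<tau> - (\<integral>t. indicator {..-u} t * ?k t \<partial>lborel)"
      using int intk K1 by simp
    also have "(\<integral>t. indicator {..-u} t * ?k t \<partial>lborel) = kernel_cdf K (- u / h)"
    proof -
      have ind: "indicator {..-u} t = (indicator {..-u/h} (t/h) :: real)" for t
        using \<open>0 < h\<close> by (auto simp: indicator_def divide_le_cancel divide_minus_left[symmetric] simp del: divide_minus_left)
      show ?thesis
        using lborel_integral_real_affine[of "1/h" "\<lambda>t. indicator {..-u/h} t * K t" 0] \<open>0 < h\<close>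
        by (simp add: kernel_cdf_def set_lebesgue_integral_def scaled_kernel_def ind)
    qed
    finally show ?thesis .
  qed
  ultimately show ?thesis unfolding DERIV_def by simp
qed

lemma gradient_emp_loss:
  assumes "0 < \<tau>" "\<tau> < 1" "0 < h" "smoothing_kernel K" "smoothed_loss_finite \<tau> K h"
  shows "gradient (emp_loss \<tau> K h n xs ys) \<beta> =
    (1 / real n) *\<^sub>R (\<Sum>i<n. (kernel_cdf K ((xs i \<bullet> \<beta> - ys i) / h) - \<tau>) *\<^sub>R xs i)"
proof (rule gradient_eqI)
  have D: "((\<lambda>\<beta>. smoothed_loss \<tau> K h (ys i - xs i \<bullet> \<beta>)) has_derivative
      (\<lambda>d. d \<bullet> ((kernel_cdf K ((xs i \<bullet> \<beta> - ys i) / h) - \<tau>) *\<^sub>R xs i))) (at \<beta>)" for i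
  proof -
    have "((\<lambda>\<beta>. ys i - xs i \<bullet> \<beta>) has_derivative (\<lambda>d. - (xs i \<bullet> d))) (at \<beta>)"
      by (auto intro!: derivative_eq_intros)
    from has_derivative_compose[OF this smoothed_loss_deriv[OF assms, unfolded has_field_derivative_def]]
    show ?thesis by (simp add: inner_commute algebra_simps)
  qed
  show "GDERIV (emp_loss \<tau> K h n xs ys) \<beta> :>
    (1 / real n) *\<^sub>R (\<Sum>i<n. (kernel_cdf K ((xs i \<bullet> \<beta> - ys i) / h) - \<tau>) *\<^sub>R xs i)"
    unfolding gderiv_def emp_loss_def[abs_def]
    by (auto intro!: derivative_eq_intros D simp: inner_sum_right sum_divide_distrib)
qed


section \<open>Penalty and iterates\<close>

(* dq is the fixed non-increasing version of q', so it need agree with the derivative of q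
   only almost everywhere. *)
definition concave_penalty :: "(real \<Rightarrow> real) \<Rightarrow> (real \<Rightarrow> real) \<Rightarrow> bool" where
  "concave_penalty q dq \<longleftrightarrow>
     (\<forall>t\<ge>0. 0 \<le> q t) \<and> mono_on {0..} q \<and> q 0 = 0 \<and>
     (AE t in lborel. 0 < t \<longrightarrow> (q has_real_derivative dq t) (at t)) \<and>
     (\<forall>t\<ge>0. 0 \<le> dq t \<and> dq t \<le> 1) \<and> (dq \<longlongrightarrow> 1) (at_right 0) \<and> dq 0 = 1 \<and>
     (\<forall>t1 t2. 0 \<le> t2 \<and> t2 \<le> t1 \<longrightarrow> dq t1 \<le> dq t2)"

(* Derivative of q_lambda(t) = lambda^2 q(t / lambda). *)
definition scaled_deriv :: "(real \<Rightarrow> real) \<Rightarrow> real \<Rightarrow> real \<Rightarrow> real" where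
  "scaled_deriv dq lam t = lam * dq (t / lam)"

(* L is the empirical loss of the observed sample. *)
definition reweighted_iterates ::
  "(real^'p \<Rightarrow> real) \<Rightarrow> (real \<Rightarrow> real) \<Rightarrow> real \<Rightarrow> (nat \<Rightarrow> real^'p) \<Rightarrow> bool" where
  "reweighted_iterates L dq lam b \<longleftrightarrow>
     b 0 = 0 \<and>
     (\<forall>m\<ge>1. is_arg_min
        (\<lambda>\<beta>. L \<beta> + (\<Sum>j\<in>UNIV. scaled_deriv dq lam \<bar>b (m - 1) $ j\<bar> * \<bar>\<beta> $ j\<bar>)) (\<lambda>_. True) (b m))"


section \<open>Local restricted strong convexity\<close>

definition rsc_event ::
  "'a measure \<Rightarrow> ('a \<Rightarrow> real^'p \<Rightarrow> real) \<Rightarrow> real^'p^'p \<Rightarrow> real^'p \<Rightarrow> real \<Rightarrow> real \<Rightarrow> real \<Rightarrow> 'a set" where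
  "rsc_event M L \<Sigma> \<beta>s r l \<kappa> =
     {\<omega> \<in> space M. \<forall>\<beta>. norm_wrt \<Sigma> (\<beta> - \<beta>s) \<le> r \<and> norm1 (\<beta> - \<beta>s) \<le> l * norm_wrt \<Sigma> (\<beta> - \<beta>s) \<longrightarrow>
        (gradient (L \<omega>) \<beta> - gradient (L \<omega>) \<beta>s) \<bullet> (\<beta> - \<beta>s) \<ge> \<kappa> * (norm_wrt \<Sigma> (\<beta> - \<beta>s))\<^sup>2}"

end

theory Submission
  imports Defs
begin

text \<open>
  Let \<open>e = bhat m - \<beta>s\<close>, \<open>p = bhat (m - 1) - \<beta>s\<close>, \<open>d = dq \<alpha>0\<close>, and let \<open>T\<close> consist of \<open>S\<close> together with the
  coordinates whose weight in the \<open>m\<close>-th program is below \<open>d * lam\<close>.  Such a coordinate outside \<open>S\<close>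
  has \<open>\<bar>p $ j\<bar> > \<alpha>0 * lam\<close>, so \<open>card T \<le> (c\<^sup>2 + 1) * s\<close> as long as \<open>norm_wrt \<Sigma> p \<le> r_opt\<close>.  Outside \<open>T\<close> the
  penalty dominates the noise \<open>w\<close>; together with monotonicity of the gradient this puts \<open>e\<close> into the
  \<open>l\<close>-cone, and restricted strong convexity bounds \<open>\<kappa> * norm_wrt \<Sigma> e\<close> by
  \<open>L2_set v T / sqrt \<gamma> + b\<close>, where \<open>v\<close> adds the weights on \<open>S\<close> to the absolute noise.
  Bounding \<open>v\<close> by constants gives \<open>norm_wrt \<Sigma> e \<le> r_opt\<close>, which keeps the iteration going; this is
  what the equation for \<open>c\<close> encodes.  Comparing \<open>v\<close> with \<open>p\<close> coordinatewise instead gives the contraction,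
  even with the factor \<open>1 / (\<alpha>0 * \<kappa> * \<gamma>) \<le> \<delta>\<close>.
\<close>

section \<open>Symmetric matrices\<close>

lemma symmetric_inner:
  fixes A :: "real^'n^'n"
  assumes "transpose A = A"
  shows "(A *v u) \<bullet> w = u \<bullet> (A *v w)"
  by (metis assms dot_lmul_matrix transpose_matrix_vector)

text \<open>Compactness gives a minimizer \<open>v\<close> of the quadratic form on the unit sphere
  of \<open>V\<close>. Moving from \<open>v\<close> along the residual \<open>w\<close> of the
  eigenvalue equation changes the form to first order by a multiple of
  \<open>(norm w)\<^sup>2\<close>, so minimality forces \<open>w = 0\<close>; invariance keeps
  \<open>w\<close> in \<open>V\<close>. A general \<open>V\<close> lets eigenvectors be split off
  one at a time.\<close>

lemma rayleigh_minimizer: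
  fixes A :: "real^'n^'n"
  assumes sym: "transpose A = A" and V: "subspace V" "V \<noteq> {0}" and inv: "\<And>u. u \<in> V \<Longrightarrow> A *v u \<in> V"
  obtains v \<mu> where "v \<in> V" "norm v = 1" "A *v v = \<mu> *\<^sub>R v"
    "\<And>u. u \<in> V \<Longrightarrow> \<mu> * (norm u)\<^sup>2 \<le> u \<bullet> (A *v u)"
proof -
  let ?f = "\<lambda>u. u \<bullet> (A *v u)"
  let ?C = "V \<inter> sphere 0 1"
  obtain u0 where u0: "u0 \<in> V" "u0 \<noteq> 0" using V subspace_0 by blast
  then have "(1 / norm u0) *\<^sub>R u0 \<in> ?C" using V by (auto simp: subspace_mul)
  moreover have "compact ?C" using closed_subspace[OF V(1)] by (simp add: closed_Int_compact)
  moreover have "continuous_on ?C ?f"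
    by (intro continuous_intros linear_continuous_on matrix_vector_mul_bounded_linear)
  ultimately obtain v where v: "v \<in> ?C" "\<And>u. u \<in> ?C \<Longrightarrow> ?f v \<le> ?f u"
    using continuous_attains_inf[of ?C ?f] by blast
  define \<mu> where "\<mu> = ?f v"
  have min: "\<mu> * (norm u)\<^sup>2 \<le> ?f u" if "u \<in> V" for u
  proof (cases "u = 0")
    case False
    then have "(1 / norm u) *\<^sub>R u \<in> ?C" using V that by (auto simp: subspace_mul)
    from v(2)[OF this] False show ?thesis
      by (simp add: \<mu>_def field_simps power2_eq_square matrix_vector_mult_scaleR)
  qed simp
  define w where "w = A *v v - \<mu> *\<^sub>R v"
  have wV: "w \<in> V" using V inv v by (auto simp: w_def intro!: subspace_diff subspace_mul)
  define C where "C = ?f w - \<mu> * (norm w)\<^sup>2"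
  have C0: "0 \<le> C" using min[OF wV] by (simp add: C_def)
  have key: "0 \<le> 2 * t * (norm w)\<^sup>2 + t\<^sup>2 * C" for t
  proof -
    have vv: "v \<bullet> v = 1" using v(1) by (simp add: dot_square_norm)
    have sw: "v \<bullet> (A *v w) = w \<bullet> (A *v v)" using symmetric_inner[OF sym, of v w] by (simp add: inner_commute)
    have nw: "(norm w)\<^sup>2 = w \<bullet> (A *v v) - \<mu> * (w \<bullet> v)"
      by (simp add: power2_norm_eq_inner inner_diff_right flip: w_def)
        (simp add: w_def inner_diff_right inner_diff_left)
    have "\<mu> * (norm (v + t *\<^sub>R w))\<^sup>2 \<le> ?f (v + t *\<^sub>R w)"
      using v wV V by (intro min) (auto intro: subspace_add subspace_mul)
    also have "?f (v + t *\<^sub>R w) = \<mu> + 2 * t * (w \<bullet> (A *v v)) + t\<^sup>2 * ?f w"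
      by (simp add: matrix_vector_right_distrib matrix_vector_mult_scaleR inner_add_left inner_add_right
          sw power2_eq_square algebra_simps \<mu>_def)
    also have "(norm (v + t *\<^sub>R w))\<^sup>2 = 1 + 2 * t * (w \<bullet> v) + t\<^sup>2 * (norm w)\<^sup>2"
      by (simp only: power2_norm_eq_inner)
        (simp add: inner_add_left inner_add_right vv power2_eq_square inner_commute algebra_simps)
    finally show ?thesis by (simp add: nw C_def algebra_simps)
  qed
  have "norm w = 0"
  proof (rule ccontr)
    assume "norm w \<noteq> 0"
    then have n: "(norm w)\<^sup>2 > 0" by simp
    \<comment> \<open>The quadratic in \<open>key\<close> is smallest at
      \<open>- (norm w)\<^sup>2 / C\<close>; adding 1 to the denominator also covers
      \<open>C = 0\<close> and keeps the value negative.\<close>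
    define t where "t = - (norm w)\<^sup>2 / (C + 1)"
    have "2 * t * (norm w)\<^sup>2 + t\<^sup>2 * C = (norm w)\<^sup>2 * (norm w)\<^sup>2 / (C+1) * (C / (C + 1) - 2)"
      using C0 by (simp add: t_def divide_simps power2_eq_square) (simp add: algebra_simps)
    also have "\<dots> < 0" using n C0 by (intro mult_pos_neg) (auto simp: divide_simps)
    finally show False using key[of t] by simp
  qed
  then have "A *v v = \<mu> *\<^sub>R v" by (simp add: w_def)
  with v(1) min show ?thesis by (intro that[of v \<mu>]) auto
qed

text \<open>A \<open>LEAST\<close> over the reals says nothing until a least element is exhibited.
  The Rayleigh minimum is one: it is an eigenvalue, and testing its inequality at any eigenvector
  puts it below the corresponding eigenvalue.\<close>

lemma min_eigenvalue_le:
  fixes A :: "real^'n^'n"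
  assumes "transpose A = A"
  shows "min_eigenvalue A * (norm u)\<^sup>2 \<le> u \<bullet> (A *v u)"
proof -
  have "(UNIV :: (real^'n) set) \<noteq> {0}" by (metis UNIV_I axis_eq_0_iff singletonD zero_neq_one)
  then obtain v \<mu> where v: "norm v = 1" "A *v v = \<mu> *\<^sub>R v"
    and min: "\<And>u. \<mu> * (norm u)\<^sup>2 \<le> u \<bullet> (A *v u)"
    using rayleigh_minimizer[OF assms subspace_UNIV] by (metis UNIV_I)
  have "min_eigenvalue A = \<mu>" unfolding min_eigenvalue_def
  proof (rule Least_equality)
    show "is_eigenvalue A \<mu>" unfolding is_eigenvalue_def using v by (intro exI[of _ v]) auto
    fix \<nu> assume "is_eigenvalue A \<nu>"
    then obtain z where z: "z \<noteq> 0" "A *v z = \<nu> *\<^sub>R z" by (auto simp: is_eigenvalue_def)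
    with min[of z] show "\<mu> \<le> \<nu>" by (simp add: power2_norm_eq_inner)
  qed
  with min show ?thesis by simp
qed

text \<open>Induction on the dimension: by symmetry, the part of \<open>V\<close> orthogonal to a
  Rayleigh eigenvector is again invariant, and it is strictly smaller.\<close>

lemma symmetric_eigenbasis:
  fixes A :: "real^'n^'n"
  assumes sym: "transpose A = A" and "subspace V" and "\<And>u. u \<in> V \<Longrightarrow> A *v u \<in> V"
  shows "\<exists>E. finite E \<and> span E = V \<and> (\<forall>e\<in>E. norm e = 1 \<and> (\<exists>\<mu>. A *v e = \<mu> *\<^sub>R e)) \<and> pairwise orthogonal E"
  using assms(2,3)
proof (induction "dim V" arbitrary: V rule: less_induct)
  case less
  show ?case
  proof (cases "V = {0}")
    case True
    then show ?thesis by (intro exI[of _ "{}"]) auto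
  next
    case False
    obtain v \<mu> where v: "v \<in> V" "norm v = 1" "A *v v = \<mu> *\<^sub>R v"
      using rayleigh_minimizer[OF sym less.prems(1) False less.prems(2)] by metis
    define W where "W = V \<inter> {u. v \<bullet> u = 0}"
    have sW: "subspace W" unfolding W_def using less.prems(1) by (intro subspace_inter subspace_hyperplane)
    have invW: "A *v u \<in> W" if "u \<in> W" for u
      using that less.prems(2) symmetric_inner[OF sym, of v u] v(3) by (auto simp: W_def)
    have "v \<notin> W" using v(2) by (simp add: W_def dot_square_norm)
    moreover have "W \<subseteq> V" by (simp add: W_def)
    ultimately have "W \<subset> V" using v(1) by blast
    then have "dim W < dim V"
      using dim_psubset[of W V] sW less.prems(1) by (simp add: span_eq_iff[THEN iffD2])
    from less.hyps[OF this sW invW] obtain E where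
      E: "finite E" "span E = W" "\<forall>e\<in>E. norm e = 1 \<and> (\<exists>\<mu>. A *v e = \<mu> *\<^sub>R e)" "pairwise orthogonal E" by auto
    have "span (insert v E) = V"
    proof (rule antisym)
      show "span (insert v E) \<subseteq> V"
        using E(2) v(1) less.prems(1) span_superset[of E] by (intro span_minimal) (auto simp: W_def)
      show "V \<subseteq> span (insert v E)"
      proof
        fix u assume u: "u \<in> V"
        have "u - (v \<bullet> u) *\<^sub>R v \<in> W"
          using u v less.prems(1) by (auto simp: W_def subspace_diff subspace_mul inner_diff_right dot_square_norm)
        then show "u \<in> span (insert v E)" using E(2) by (auto simp: span_insert)
      qed
    qed
    moreover have "orthogonal v e" if "e \<in> E" for e
      using that E(2) span_base[of e E] by (auto simp: W_def orthogonal_def)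
    ultimately show ?thesis using E v
      by (intro exI[of _ "insert v E"]) (auto simp: pairwise_insert orthogonal_commute)
  qed
qed

text \<open>The root keeps the eigenvectors and takes square roots of the eigenvalues; for a unit
  eigenvector \<open>e\<close> the eigenvalue is \<open>e \<bullet> (A *v e)\<close>. Existence is
  what gives content to the choice in \<open>matrix_sqrt\<close>.\<close>

lemma pos_semidef_sqrt_exists:
  fixes A :: "real^'n^'n"
  assumes "pos_semidef A"
  shows "\<exists>B. pos_semidef B \<and> B ** B = A"
proof -
  have sym: "transpose A = A" and pos: "0 \<le> v \<bullet> (A *v v)" for v
    using assms by (auto simp: pos_semidef_def)
  obtain E where E: "finite E" "span E = (UNIV :: (real^'n) set)"
      "\<And>e. e \<in> E \<Longrightarrow> norm e = 1" "\<And>e. e \<in> E \<Longrightarrow> \<exists>\<mu>. A *v e = \<mu> *\<^sub>R e" "pairwise orthogonal E"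
    using symmetric_eigenbasis[OF sym subspace_UNIV] by auto
  define m where "m e = sqrt (e \<bullet> (A *v e))" for e
  define B :: "real^'n^'n" where "B = (\<chi> i j. \<Sum>e\<in>E. m e * (e $ i * e $ j))"
  have Bv: "B *v u = (\<Sum>e\<in>E. (m e * (e \<bullet> u)) *\<^sub>R e)" for u
    by (simp add: B_def vec_eq_iff matrix_vector_mult_def inner_vec_def sum_distrib_left sum_distrib_right
        sum.swap[of _ E] mult_ac)
  have Be: "B *v e = m e *\<^sub>R e" if e: "e \<in> E" for e
  proof -
    have "B *v e = (\<Sum>a\<in>E. if a = e then m e *\<^sub>R e else 0)" unfolding Bv
      using E(3)[OF e] E(5) e by (intro sum.cong) (auto simp: dot_square_norm pairwise_def orthogonal_def)
    then show ?thesis using E(1) e by simp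
  qed
  have "B *v (B *v e) = A *v e" if e: "e \<in> E" for e
  proof -
    obtain \<mu> where \<mu>: "A *v e = \<mu> *\<^sub>R e" using E(4)[OF e] by auto
    have "m e * m e = e \<bullet> (A *v e)" using pos[of e] by (simp add: m_def)
    also have "\<dots> = \<mu>" using \<mu> E(3)[OF e] by (simp add: dot_square_norm)
    finally show ?thesis using \<mu> by (simp add: Be[OF e] matrix_vector_mult_scaleR)
  qed
  then have "(B ** B) *v u = A *v u" for u
    by (intro linear_eq_on_span[of "(*v) (B ** B)" "(*v) A" E u])
      (auto simp: E(2) simp flip: matrix_vector_mul_assoc)
  then have "B ** B = A" by (simp add: matrix_eq)
  moreover have "transpose B = B" by (simp add: B_def transpose_def vec_eq_iff mult.commute)
  moreover have "0 \<le> v \<bullet> (B *v v)" for v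
    unfolding Bv inner_sum_right
    by (intro sum_nonneg) (use pos in \<open>auto simp: m_def inner_commute[of v] mult.assoc\<close>)
  ultimately show ?thesis unfolding pos_semidef_def by blast
qed

lemma matrix_sqrt:
  assumes "pos_semidef A"
  shows "pos_semidef (matrix_sqrt A)" "matrix_sqrt A ** matrix_sqrt A = A"
  using someI_ex[OF pos_semidef_sqrt_exists[OF assms]] by (simp_all add: matrix_sqrt_def)

lemma norm_wrt_power2:
  assumes "pos_semidef A"
  shows "(norm_wrt A u)\<^sup>2 = u \<bullet> (A *v u)"
proof -
  have "transpose (matrix_sqrt A) = matrix_sqrt A" using matrix_sqrt(1)[OF assms] by (simp add: pos_semidef_def)
  then show ?thesis unfolding norm_wrt_def power2_norm_eq_inner
    by (simp add: symmetric_inner matrix_vector_mul_assoc matrix_sqrt(2)[OF assms])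
qed

lemma min_eigenvalue_norm_le:
  assumes "pos_semidef A" "0 \<le> min_eigenvalue A"
  shows "sqrt (min_eigenvalue A) * norm u \<le> norm_wrt A u"
proof (rule power2_le_imp_le)
  show "(sqrt (min_eigenvalue A) * norm u)\<^sup>2 \<le> (norm_wrt A u)\<^sup>2"
    using min_eigenvalue_le[of A u] assms by (simp add: norm_wrt_power2 power_mult_distrib pos_semidef_def)
qed (simp add: norm_wrt_def)

lemma norm_wrt_scaleR: "norm_wrt A (t *\<^sub>R u) = \<bar>t\<bar> * norm_wrt A u"
  by (simp add: norm_wrt_def matrix_vector_mult_scaleR)

lemma pos_def_imp_pos_semidef: "pos_def A \<Longrightarrow> pos_semidef A"
  unfolding pos_def_def pos_semidef_def by (metis inner_zero_left less_imp_le order_refl)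

text \<open>Since the root is symmetric and invertible, it can be moved from one factor of the inner
  product to the other, and Cauchy-Schwarz applies. This is how the smoothing bias enters the error
  bounds.\<close>

lemma inner_le_dual_norm_wrt:
  assumes "pos_def A"
  shows "\<bar>g \<bullet> u\<bar> \<le> norm (matrix_inv (matrix_sqrt A) *v g) * norm_wrt A u"
proof -
  let ?B = "matrix_sqrt A"
  note psd = pos_def_imp_pos_semidef[OF assms]
  have sym: "transpose ?B = ?B" using matrix_sqrt(1)[OF psd] by (simp add: pos_semidef_def)
  have "v = 0" if "?B *v v = 0" for v
  proof (rule ccontr)
    assume "v \<noteq> 0"
    with assms have "0 < v \<bullet> (A *v v)" by (simp add: pos_def_def)
    then show False using norm_wrt_power2[OF psd, of v] that by (simp add: norm_wrt_def)
  qed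
  then have "invertible ?B" by (simp add: invertible_left_inverse matrix_left_invertible_ker)
  then have "?B ** matrix_inv ?B = mat 1"
    unfolding invertible_def matrix_inv_def by (rule someI_ex[THEN conjunct1])
  then have "?B *v (matrix_inv ?B *v g) = g"
    by (simp add: matrix_vector_mul_assoc)
  then have "g \<bullet> u = (matrix_inv ?B *v g) \<bullet> (?B *v u)"
    by (metis symmetric_inner[OF sym])
  then show ?thesis by (simp add: norm_wrt_def Cauchy_Schwarz_ineq2)
qed

section \<open>Convexity and optimality\<close>

lemma kernel_cdf_mono:
  assumes "smoothing_kernel K"
  shows "mono (kernel_cdf K)"
proof
  fix a b :: real assume "a \<le> b"
  have int: "integrable lborel K" and nonneg: "\<And>t. 0 \<le> K t"
    using assms by (auto simp: smoothing_kernel_def has_bochner_integral_iff)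
  have "integrable lborel (\<lambda>t. indicator {..u} t *\<^sub>R K t)" for u
    using integrable_mult_indicator[OF _ int, of "{..u}"] by simp
  then show "kernel_cdf K a \<le> kernel_cdf K b"
    unfolding kernel_cdf_def set_lebesgue_integral_def
    using \<open>a \<le> b\<close> nonneg by (intro integral_mono) (auto simp: indicator_def)
qed

context
  fixes \<tau> h :: real and K :: "real \<Rightarrow> real"
  assumes loss: "0 < \<tau>" "\<tau> < 1" "0 < h" "smoothing_kernel K" "smoothed_loss_finite \<tau> K h"
begin

lemma emp_loss_line_deriv:
  "((\<lambda>t. emp_loss \<tau> K h n xs ys (\<beta> + t *\<^sub>R v)) has_real_derivative
     gradient (emp_loss \<tau> K h n xs ys) (\<beta> + t *\<^sub>R v) \<bullet> v) (at t)"
proof -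
  let ?u = "\<lambda>i t. ys i - xs i \<bullet> (\<beta> + t *\<^sub>R v)"
  have "((\<lambda>t. smoothed_loss \<tau> K h (?u i t)) has_real_derivative
      (kernel_cdf K ((xs i \<bullet> (\<beta> + t *\<^sub>R v) - ys i) / h) - \<tau>) * (xs i \<bullet> v)) (at t)" for i
  proof -
    have "(?u i has_real_derivative - (xs i \<bullet> v)) (at t)"
      by (auto intro!: derivative_eq_intros simp: inner_add_right)
    from DERIV_chain2[OF smoothed_loss_deriv[OF loss] this] show ?thesis
      by (simp add: algebra_simps)
  qed
  from DERIV_cdivide[OF DERIV_sum[OF this, where S = "{..<n}"], where c = "real n"] show ?thesis
    unfolding emp_loss_def gradient_emp_loss[OF loss, unfolded emp_loss_def]
    by (simp add: inner_sum_left)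
qed

text \<open>Convexity of the loss, in the form needed later. In each summand the argument of
  \<open>kernel_cdf\<close> moves with the sign of \<open>xs i \<bullet> v\<close>, and the same
  factor multiplies the result, so the two signs cancel.\<close>

lemma gradient_emp_loss_line_mono:
  assumes "s \<le> t"
  shows "gradient (emp_loss \<tau> K h n xs ys) (\<beta> + s *\<^sub>R v) \<bullet> v
       \<le> gradient (emp_loss \<tau> K h n xs ys) (\<beta> + t *\<^sub>R v) \<bullet> v"
proof -
  let ?F = "\<lambda>i t. kernel_cdf K ((xs i \<bullet> (\<beta> + t *\<^sub>R v) - ys i) / h)"
  have "(?F i s - \<tau>) * (xs i \<bullet> v) \<le> (?F i t - \<tau>) * (xs i \<bullet> v)" for i
  proof (cases "0 \<le> xs i \<bullet> v")
    case True
    then have "?F i s \<le> ?F i t"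
      using assms loss by (intro monoD[OF kernel_cdf_mono]) (auto simp: inner_add_right divide_right_mono mult_right_mono)
    then show ?thesis using True by (simp add: mult_right_mono)
  next
    case False
    then have "?F i t \<le> ?F i s"
      using assms loss by (intro monoD[OF kernel_cdf_mono]) (auto simp: inner_add_right divide_right_mono mult_right_mono_neg)
    then show ?thesis using False by (simp add: mult_right_mono_neg)
  qed
  then show ?thesis unfolding gradient_emp_loss[OF loss]
    by (simp add: inner_sum_left divide_right_mono sum_mono)
qed

end

text \<open>This variational inequality replaces the subgradient form of the optimality conditions.\<close>

lemma minimizer_variational_ineq:
  fixes F P :: "'v::real_vector \<Rightarrow> real"
  assumes min: "\<And>z. F x + P x \<le> F z + P z"
    and conv: "convex_on UNIV P"
    and deriv: "((\<lambda>t. F (x + t *\<^sub>R v)) has_real_derivative D) (at 0)"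
  shows "0 \<le> D + (P (x + v) - P x)"
proof -
  have lim: "((\<lambda>t. (F (x + t *\<^sub>R v) - F x) / t + (P (x + v) - P x)) \<longlongrightarrow> D + (P (x + v) - P x)) (at_right 0)"
    using deriv unfolding DERIV_def by (auto intro!: tendsto_intros elim: tendsto_within_subset)
  have "\<forall>\<^sub>F t in at_right 0. 0 \<le> (F (x + t *\<^sub>R v) - F x) / t + (P (x + v) - P x)"
    using eventually_at_right_less[of 0] eventually_at_right_real[of 0 1, OF zero_less_one]
  proof eventually_elim
    case (elim t)
    then have t: "0 < t" "t < 1" by auto
    \<comment> \<open>Convexity bounds the increment of \<open>P\<close> over the short step by
      \<open>t\<close> times its full increment, so only \<open>F\<close> has to be
      differentiated.\<close>
    have "x + t *\<^sub>R v = (1 - t) *\<^sub>R x + t *\<^sub>R (x + v)" by (simp add: algebra_simps)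
    then have "P (x + t *\<^sub>R v) \<le> (1 - t) * P x + t * P (x + v)"
      using convex_onD[OF conv, of t x "x + v"] t by simp
    with min[of "x + t *\<^sub>R v"] have "0 \<le> (F (x + t *\<^sub>R v) - F x) + t * (P (x + v) - P x)"
      by (simp add: algebra_simps)
    with t show ?case by (simp add: field_simps)
  qed
  with tendsto_lowerbound[OF lim this] show ?thesis by simp
qed

lemma convex_on_weighted_l1:
  fixes wt :: "'p::finite \<Rightarrow> real"
  assumes "\<And>j. 0 \<le> wt j"
  shows "convex_on UNIV (\<lambda>\<beta>::real^'p. \<Sum>j\<in>UNIV. wt j * \<bar>\<beta> $ j\<bar>)"
proof (rule convex_onI)
  fix t :: real and x y :: "real^'p" assume t: "0 < t" "t < 1"
  have "wt j * \<bar>((1 - t) *\<^sub>R x + t *\<^sub>R y) $ j\<bar> \<le> (1 - t) * (wt j * \<bar>x $ j\<bar>) + t * (wt j * \<bar>y $ j\<bar>)" for j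
  proof -
    have "\<bar>(1 - t) * x $ j + t * y $ j\<bar> \<le> (1 - t) * \<bar>x $ j\<bar> + t * \<bar>y $ j\<bar>"
      using t by (intro order_trans[OF abs_triangle_ineq]) (simp add: abs_mult)
    from mult_left_mono[OF this assms[of j]] show ?thesis by (simp add: algebra_simps)
  qed
  then show "(\<Sum>j\<in>UNIV. wt j * \<bar>((1 - t) *\<^sub>R x + t *\<^sub>R y) $ j\<bar>)
      \<le> (1 - t) * (\<Sum>j\<in>UNIV. wt j * \<bar>x $ j\<bar>) + t * (\<Sum>j\<in>UNIV. wt j * \<bar>y $ j\<bar>)"
    by (simp add: sum_distrib_left sum_mono flip: sum.distrib)
qed simp

text \<open>An error vector of size \<open>N > r\<close> is shrunk by \<open>u = r / N\<close> onto the sphere of radius \<open>r\<close>, where strong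
  convexity is available; \<open>\<phi> u\<close> is the increment of the gradient at the shrunken point along the
  error.\<close>

lemma localization:
  fixes \<phi> :: "real \<Rightarrow> real"
  assumes rsc: "\<And>u. 0 \<le> u \<Longrightarrow> u \<le> 1 \<Longrightarrow> u * N \<le> r \<Longrightarrow> \<kappa> * (u * N)\<^sup>2 \<le> u * \<phi> u"
    and mono: "\<And>u. 0 \<le> u \<Longrightarrow> u \<le> 1 \<Longrightarrow> \<phi> u \<le> \<phi> 1"
    and upper: "\<phi> 1 \<le> R * N"
    and pos: "0 \<le> N" "0 < \<kappa>" "0 \<le> R" "R < \<kappa> * r"
  shows "\<kappa> * N \<le> R"
proof -
  have r: "0 < r" using pos zero_less_mult_pos[of \<kappa> r] by simp
  have "N \<le> r"
  proof (rule ccontr)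
    assume "\<not> N \<le> r"
    define u where "u = r / N"
    have u: "0 < u" "u \<le> 1" "u * N = r" using \<open>\<not> N \<le> r\<close> r by (auto simp: u_def)
    have "\<kappa> * r\<^sup>2 \<le> u * \<phi> u" using rsc[of u] u by simp
    also have "\<dots> \<le> u * (R * N)" using mono[of u] upper u by (intro mult_left_mono) auto
    also have "\<dots> = r * R" using u by (metis mult.assoc mult.commute)
    \<comment> \<open>Cancelling \<open>r > 0\<close> leaves \<open>\<kappa> * r \<le> R\<close>,
      against the strict hypothesis.\<close>
    finally show False using r pos by (simp add: power2_eq_square algebra_simps)
  qed
  then have "\<kappa> * N\<^sup>2 \<le> R * N" using rsc[of 1] upper by simp
  then show "\<kappa> * N \<le> R" using pos by (cases "N = 0") (auto simp: power2_eq_square)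
qed

text \<open>The geometric recursion is started at index 1, where the radius bound is available; the
  error of the zero start may be larger. Hence the exponent \<open>m - 1\<close>.\<close>

lemma contraction_iterate:
  fixes a :: "nat \<Rightarrow> real"
  assumes step: "\<And>m. m \<ge> 2 \<Longrightarrow> a m \<le> \<delta> * a (m - 1) + e"
    and init: "a 1 \<le> A" and \<delta>: "0 \<le> \<delta>" "\<delta> < 1" and e: "0 \<le> e" and m: "1 \<le> m"
  shows "a m \<le> \<delta> ^ (m - 1) * A + e / (1 - \<delta>)"
  using m
proof (induction m rule: dec_induct)
  case base
  have "0 \<le> e / (1 - \<delta>)" using e \<delta> by simp
  with init show ?case by simp
next
  case (step m)
  have "a (Suc m) \<le> \<delta> * a m + e" using assms(1)[of "Suc m"] step by simp
  also have "\<dots> \<le> \<delta> * (\<delta> ^ (m - 1) * A + e / (1 - \<delta>)) + e"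
    using step \<delta> by (intro add_right_mono mult_left_mono) auto
  also have "\<dots> = \<delta> ^ (Suc m - 1) * A + e / (1 - \<delta>)"
    using \<delta> step(1) by (cases m) (auto simp: field_simps)
  finally show ?case .
qed

text \<open>The function \<open>A * c - d / 2 * sqrt (c\<^sup>2 + 1)\<close> is nonpositive at \<open>0\<close> and grows with slope at least
  \<open>A - d / 2\<close>.\<close>

lemma ex1_radius:
  fixes A d :: real
  assumes "0 \<le> d" "d / 2 < A"
  shows "\<exists>!c. 0 < c \<and> 0.5 * d * sqrt (c\<^sup>2 + 1) + 2 = A * c"
proof -
  have lip: "sqrt (x\<^sup>2 + 1) \<le> sqrt (y\<^sup>2 + 1) + (x - y)" if "0 \<le> y" "y \<le> x" for x y :: real
  proof (rule real_le_lsqrt)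
    have "y \<le> sqrt (y\<^sup>2 + 1)" by (rule real_le_rsqrt) simp
    then have "0 \<le> 2 * (x - y) * (sqrt (y\<^sup>2 + 1) - y)" using that by simp
    moreover have "(sqrt (y\<^sup>2 + 1))\<^sup>2 = y\<^sup>2 + 1" by simp
    ultimately show "x\<^sup>2 + 1 \<le> (sqrt (y\<^sup>2 + 1) + (x - y))\<^sup>2"
      by (simp add: power2_eq_square algebra_simps)
  qed (use that in auto)
  let ?g = "\<lambda>c. A * c - 0.5 * d * sqrt (c\<^sup>2 + 1)"
  have incr: "(A - d / 2) * (x - y) \<le> ?g x - ?g y" if "0 \<le> y" "y \<le> x" for x y
    using mult_left_mono[OF lip[OF that], of "0.5 * d"] assms(1) by (simp add: field_simps)
  \<comment> \<open>\<open>?g 0 = - d / 2\<close>, so a line of slope \<open>A - d / 2\<close> from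
    there reaches height 2 exactly at \<open>c1\<close>.\<close>
  define c1 where "c1 = (2 + d / 2) / (A - d / 2)"
  have c1: "0 < c1" "(A - d / 2) * c1 = 2 + d / 2" using assms by (auto simp: c1_def)
  have "2 \<le> ?g c1" using incr[of 0 c1] c1 by simp
  moreover have "?g 0 \<le> 2" using assms by simp
  moreover have "continuous_on {0..c1} ?g" by (intro continuous_intros)
  ultimately obtain c where c: "0 \<le> c" "?g c = 2" using IVT'[of ?g 0 2 c1] c1 by auto
  have "c \<noteq> 0" using c assms by auto
  show ?thesis
  proof (rule ex1I[of _ c])
    show "0 < c \<and> 0.5 * d * sqrt (c\<^sup>2 + 1) + 2 = A * c" using c \<open>c \<noteq> 0\<close> by auto
    fix c' assume c': "0 < c' \<and> 0.5 * d * sqrt (c'\<^sup>2 + 1) + 2 = A * c'"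
    then have g': "?g c' = 2" by simp
    have "(A - d / 2) * \<bar>c' - c\<bar> \<le> 0"
      using incr[of c c'] incr[of c' c] c c' g' by (cases "c \<le> c'") auto
    then show "c' = c" using assms by (simp add: mult_le_0_iff)
  qed
qed

section \<open>One reweighted program\<close>

text \<open>Coordinate by coordinate: on \<open>S\<close> the triangle inequality costs at most the
  weight; on \<open>T - S\<close> the true coefficient vanishes, so the penalty only helps and is
  dropped; outside \<open>T\<close> a weight of at least \<open>2 * \<eta>\<close> absorbs noise of
  size \<open>\<eta>\<close> and leaves \<open>- \<eta>\<close>.\<close>

lemma penalized_error_ineq:
  fixes \<beta> e w g :: "real^'p" and wt :: "'p::finite \<Rightarrow> real"
  assumes S: "S = {j. \<beta> $ j \<noteq> 0}" "S \<subseteq> T"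
    and wt: "\<And>j. 0 \<le> wt j" "\<And>j. j \<notin> T \<Longrightarrow> 2 * \<eta> \<le> wt j"
    and w: "\<And>j. \<bar>w $ j\<bar> \<le> \<eta>"
    and opt: "D \<le> (\<Sum>j\<in>UNIV. wt j * \<bar>\<beta> $ j\<bar>) - (\<Sum>j\<in>UNIV. wt j * \<bar>(\<beta> + e) $ j\<bar>)"
    and g: "- (g \<bullet> e) \<le> B"
  shows "D - (w + g) \<bullet> e
    \<le> (\<Sum>j\<in>T. ((if j \<in> S then wt j else 0) + \<bar>w $ j\<bar>) * \<bar>e $ j\<bar>) - \<eta> * (\<Sum>j\<in>-T. \<bar>e $ j\<bar>) + B"
proof -
  let ?v = "\<lambda>j. ((if j \<in> S then wt j else 0) + \<bar>w $ j\<bar>) * \<bar>e $ j\<bar>"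
  have pt: "wt j * \<bar>\<beta> $ j\<bar> - wt j * \<bar>(\<beta> + e) $ j\<bar> - w $ j * e $ j
      \<le> (if j \<in> T then ?v j else - \<eta> * \<bar>e $ j\<bar>)" for j
  proof -
    have we: "- (w $ j * e $ j) \<le> \<bar>w $ j\<bar> * \<bar>e $ j\<bar>" by (metis abs_ge_minus_self abs_mult)
    consider "j \<in> S" "j \<in> T" | "j \<notin> S" "j \<in> T" | "j \<notin> S" "j \<notin> T" using S by auto
    then show ?thesis
    proof cases
      case 1
      have "wt j * (\<bar>\<beta> $ j\<bar> - \<bar>(\<beta> + e) $ j\<bar>) \<le> wt j * \<bar>e $ j\<bar>" using wt(1) by (intro mult_left_mono) auto
      with 1 we show ?thesis by (simp add: algebra_simps)
    next
      case 2
      have "0 \<le> wt j * \<bar>e $ j\<bar>" using wt(1) by simp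
      with 2 we S show ?thesis by auto
    next
      case 3
      have "\<bar>w $ j\<bar> * \<bar>e $ j\<bar> \<le> \<eta> * \<bar>e $ j\<bar>" "2 * \<eta> * \<bar>e $ j\<bar> \<le> wt j * \<bar>e $ j\<bar>"
        using wt(2)[of j] w[of j] 3 by (auto intro!: mult_right_mono)
      with 3 we S show ?thesis by auto
    qed
  qed
  have "D - (w + g) \<bullet> e \<le> (\<Sum>j\<in>UNIV. wt j * \<bar>\<beta> $ j\<bar> - wt j * \<bar>(\<beta> + e) $ j\<bar> - w $ j * e $ j) + B"
    using opt g by (simp add: inner_vec_def[of w] inner_add_left sum_subtractf)
  also have "\<dots> \<le> (\<Sum>j\<in>UNIV. if j \<in> T then ?v j else - \<eta> * \<bar>e $ j\<bar>) + B"
    by (intro add_right_mono sum_mono pt)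
  also have "(\<Sum>j\<in>UNIV. if j \<in> T then ?v j else - \<eta> * \<bar>e $ j\<bar>)
      = sum ?v T + (\<Sum>j\<in>-T. - \<eta> * \<bar>e $ j\<bar>)"
    using sum.If_cases[of UNIV "\<lambda>j. j \<in> T" ?v "\<lambda>j. - \<eta> * \<bar>e $ j\<bar>"] by (simp add: Compl_eq)
  finally show ?thesis by (simp add: sum_negf sum_distrib_left)
qed

section \<open>Euclidean bounds for the error and the weights\<close>

lemma sum_abs_le_L2_set: "(\<Sum>j\<in>T. \<bar>f j\<bar>) \<le> sqrt (card T) * L2_set f T"
  using L2_set_mult_ineq[of "\<lambda>_. 1" f T] by (simp add: L2_set_constant)

lemma L2_set_le_norm: "L2_set (\<lambda>j. u $ j) T \<le> norm u"
  unfolding norm_vec_def L2_set_def real_norm_def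
  by (auto intro!: real_sqrt_le_mono sum_mono2)

text \<open>Dividing the inequality by \<open>d / 2 * lam\<close> bounds the part of
  \<open>e\<close> outside \<open>T\<close> by \<open>1 + 2 / d\<close> times the part inside, plus
  the bias. Adding the inside part gives \<open>2 + 2 / d\<close>, and Cauchy-Schwarz on
  \<open>T\<close> produces the factor \<open>sqrt (c\<^sup>2 + 1)\<close>.\<close>

lemma error_cone:
  fixes e w :: "real^'p" and wt :: "'p::finite \<Rightarrow> real"
  assumes ineq: "0 \<le> (\<Sum>j\<in>T. ((if j \<in> S then wt j else 0) + \<bar>w $ j\<bar>) * \<bar>e $ j\<bar>)
      - d / 2 * lam * (\<Sum>j\<in>-T. \<bar>e $ j\<bar>) + b * N"
    and wt: "\<And>j. wt j \<le> lam" and w: "\<And>j. \<bar>w $ j\<bar> \<le> d / 2 * lam"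
    and pos: "0 < d" "0 < lam" "0 \<le> N" "0 < \<gamma>" "0 \<le> s"
    and N: "sqrt \<gamma> * norm e \<le> N" and b: "b \<le> sqrt (s / \<gamma>) * lam"
    and T: "real (card T) \<le> (c\<^sup>2 + 1) * s"
  shows "norm1 e \<le> ((2 + 2 / d) * sqrt (c\<^sup>2 + 1) + 2 / d) * sqrt (s / \<gamma>) * N"
proof -
  let ?A = "\<Sum>j\<in>T. \<bar>e $ j\<bar>" and ?C = "\<Sum>j\<in>-T. \<bar>e $ j\<bar>"
  have "norm e \<le> N / sqrt \<gamma>" using N pos by (simp add: field_simps)
  then have "L2_set (\<lambda>j. e $ j) T \<le> N / sqrt \<gamma>" using L2_set_le_norm order_trans by blast
  moreover have "sqrt (real (card T)) \<le> sqrt ((c\<^sup>2 + 1) * s)" using T by simp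
  ultimately have "sqrt (card T) * L2_set (\<lambda>j. e $ j) T \<le> sqrt ((c\<^sup>2 + 1) * s) * (N / sqrt \<gamma>)"
    using pos by (intro mult_mono) auto
  then have A: "?A \<le> sqrt (c\<^sup>2 + 1) * sqrt (s / \<gamma>) * N"
    using sum_abs_le_L2_set[of "\<lambda>j. e $ j" T] by (simp add: real_sqrt_mult real_sqrt_divide mult_ac)
  have "(\<Sum>j\<in>T. ((if j \<in> S then wt j else 0) + \<bar>w $ j\<bar>) * \<bar>e $ j\<bar>)
      \<le> (\<Sum>j\<in>T. (lam + d / 2 * lam) * \<bar>e $ j\<bar>)"
    using wt w pos by (intro sum_mono mult_right_mono add_mono) auto
  also have "\<dots> = (lam + d / 2 * lam) * ?A" by (simp add: sum_distrib_left)
  finally have "d / 2 * lam * ?C \<le> (lam + d / 2 * lam) * ?A + b * N" using ineq by simp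
  also have "b * N \<le> sqrt (s / \<gamma>) * lam * N" using b pos by (intro mult_right_mono)
  finally have "d / 2 * lam * ?C \<le> d / 2 * lam * ((1 + 2 / d) * ?A + 2 / d * sqrt (s / \<gamma>) * N)"
    using pos by (simp add: algebra_simps)
  then have C: "?C \<le> (1 + 2 / d) * ?A + 2 / d * sqrt (s / \<gamma>) * N" using pos by simp
  have "norm1 e = ?A + ?C"
    unfolding norm1_def by (subst sum.union_disjoint[symmetric]) auto
  also have "\<dots> \<le> (2 + 2 / d) * ?A + 2 / d * sqrt (s / \<gamma>) * N" using C by (simp add: algebra_simps)
  also have "\<dots> \<le> (2 + 2 / d) * (sqrt (c\<^sup>2 + 1) * sqrt (s / \<gamma>) * N) + 2 / d * sqrt (s / \<gamma>) * N"
    using pos by (intro add_right_mono mult_left_mono A) auto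
  finally show ?thesis by (simp add: algebra_simps)
qed

lemma L2_set_support: "finite T \<Longrightarrow> S \<subseteq> T \<Longrightarrow> L2_set (\<lambda>j. if j \<in> S then f j else 0) T = L2_set f S"
  unfolding L2_set_def by (simp add: if_distrib[of "\<lambda>z. z\<^sup>2"] sum.inter_restrict[symmetric] Int_absorb1 cong: if_cong)

text \<open>On \<open>S\<close> the square of \<open>lam + d / 2 * lam\<close> has cross term
  \<open>d * lam\<^sup>2\<close>. Enlarging it by the factor \<open>sqrt (c\<^sup>2 + 1) > 1\<close>
  completes the square of the right-hand side; this enlargement also makes the bound strict.\<close>

lemma weight_L2_crude:
  fixes wt w :: "'p \<Rightarrow> real"
  assumes "finite T" "S \<subseteq> T" "0 < card S"
    and wt: "\<And>j. 0 \<le> wt j" "\<And>j. wt j \<le> lam" and w: "\<And>j. \<bar>w j\<bar> \<le> d / 2 * lam"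
    and pos: "0 < d" "0 < lam" "0 < c"
    and T: "real (card T) \<le> (c\<^sup>2 + 1) * real (card S)"
  shows "L2_set (\<lambda>j. (if j \<in> S then wt j else 0) + \<bar>w j\<bar>) T
    < (1 + d / 2 * sqrt (c\<^sup>2 + 1)) * sqrt (real (card S)) * lam"
proof (rule power2_less_imp_less)
  let ?s = "real (card S)"
  have fS: "finite S" using assms finite_subset by blast
  have "(L2_set (\<lambda>j. (if j \<in> S then wt j else 0) + \<bar>w j\<bar>) T)\<^sup>2
      = (\<Sum>j\<in>T. ((if j \<in> S then wt j else 0) + \<bar>w j\<bar>)\<^sup>2)"
    by (simp add: L2_set_def sum_nonneg)
  also have "\<dots> \<le> (\<Sum>j\<in>T. (if j \<in> S then (1 + d) * lam\<^sup>2 else 0) + (d / 2 * lam)\<^sup>2)"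
  proof (rule sum_mono)
    fix j
    have "((if j \<in> S then wt j else 0) + \<bar>w j\<bar>)\<^sup>2 \<le> ((if j \<in> S then lam else 0) + d / 2 * lam)\<^sup>2"
      using wt w by (intro power_mono add_mono add_nonneg_nonneg) auto
    also have "\<dots> = (if j \<in> S then (1 + d) * lam\<^sup>2 else 0) + (d / 2 * lam)\<^sup>2"
      by (simp add: power2_eq_square algebra_simps)
    finally show "((if j \<in> S then wt j else 0) + \<bar>w j\<bar>)\<^sup>2 \<le> \<dots>" .
  qed
  also have "\<dots> = (1 + d) * lam\<^sup>2 * ?s + (d / 2 * lam)\<^sup>2 * real (card T)"
    using assms(1,2) by (simp add: sum.distrib sum.inter_restrict[symmetric] Int_absorb1)
  also have "\<dots> \<le> (1 + d) * lam\<^sup>2 * ?s + (d / 2 * lam)\<^sup>2 * ((c\<^sup>2 + 1) * ?s)"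
    by (intro add_left_mono mult_left_mono T) auto
  also have "\<dots> < (1 + d * sqrt (c\<^sup>2 + 1)) * lam\<^sup>2 * ?s + (d / 2 * lam)\<^sup>2 * ((c\<^sup>2 + 1) * ?s)"
    using pos assms(3) by (intro add_strict_right_mono mult_strict_right_mono) auto
  also have "\<dots> = ((1 + d / 2 * sqrt (c\<^sup>2 + 1)) * sqrt ?s * lam)\<^sup>2"
    by (simp add: power_mult_distrib power2_sum field_simps power2_eq_square[of lam])
  finally show "(L2_set (\<lambda>j. (if j \<in> S then wt j else 0) + \<bar>w j\<bar>) T)\<^sup>2 < \<dots>" .
  show "0 \<le> (1 + d / 2 * sqrt (c\<^sup>2 + 1)) * sqrt ?s * lam" using pos by simp
qed

text \<open>The vector \<open>p / \<alpha>\<close> controls the excess weight on \<open>S\<close>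
  and the noise on \<open>T - S\<close>. These index sets are disjoint, so Minkowski's inequality
  counts \<open>p\<close> only once.\<close>

lemma weight_L2_refined:
  fixes wt w a :: "'p::finite \<Rightarrow> real" and p :: "real^'p"
  assumes "S \<subseteq> T" and \<alpha>: "0 < \<alpha>"
    and wt: "\<And>j. j \<in> S \<Longrightarrow> 0 \<le> wt j" "\<And>j. j \<in> S \<Longrightarrow> wt j \<le> a j + \<bar>p $ j\<bar> / \<alpha>"
    and w: "\<And>j. j \<in> T - S \<Longrightarrow> \<bar>w j\<bar> \<le> \<bar>p $ j\<bar> / \<alpha>"
  shows "L2_set (\<lambda>j. (if j \<in> S then wt j else 0) + \<bar>w j\<bar>) T \<le> L2_set a S + L2_set w S + norm p / \<alpha>"
proof -
  let ?r = "\<lambda>f j. if j \<in> S then f j else (0::real)"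
  have "L2_set (\<lambda>j. ?r wt j + \<bar>w j\<bar>) T \<le> L2_set (\<lambda>j. (?r a j + ?r (\<lambda>j. \<bar>w j\<bar>) j) + \<bar>p $ j\<bar> / \<alpha>) T"
    using wt w by (intro L2_set_mono) fastforce+
  also have "\<dots> \<le> L2_set (?r a) T + L2_set (?r (\<lambda>j. \<bar>w j\<bar>)) T + L2_set (\<lambda>j. \<bar>p $ j\<bar> / \<alpha>) T"
    by (intro order_trans[OF L2_set_triangle_ineq] add_right_mono L2_set_triangle_ineq)
  also have "L2_set (\<lambda>j. \<bar>p $ j\<bar> / \<alpha>) T = L2_set (\<lambda>j. p $ j) T / \<alpha>"
    using L2_set_left_distrib[of "1 / \<alpha>" "\<lambda>j. \<bar>p $ j\<bar>" T] \<alpha> by (simp add: L2_set_def)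
  also have "\<dots> \<le> norm p / \<alpha>" using \<alpha> L2_set_le_norm[of p T] by (simp add: divide_right_mono)
  finally show ?thesis using assms(1) by (simp add: L2_set_support) (simp add: L2_set_def)
qed

lemma card_thresholded_le:
  fixes p :: "real^'p"
  assumes "0 \<le> a" "\<And>j. j \<in> A \<Longrightarrow> a \<le> \<bar>p $ j\<bar>"
  shows "real (card A) * a\<^sup>2 \<le> (norm p)\<^sup>2"
proof -
  have "sqrt (real (card A)) * a = L2_set (\<lambda>_. a) A" using assms by (simp add: L2_set_constant)
  also have "\<dots> \<le> L2_set (\<lambda>j. \<bar>p $ j\<bar>) A" using assms by (intro L2_set_mono) auto
  also have "\<dots> = L2_set (\<lambda>j. p $ j) A" by (simp add: L2_set_def)
  also have "\<dots> \<le> norm p" by (rule L2_set_le_norm)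
  finally have "(sqrt (real (card A)) * a)\<^sup>2 \<le> (norm p)\<^sup>2" using assms by (intro power_mono) auto
  then show ?thesis by (simp add: power_mult_distrib)
qed

text \<open>The bound by \<open>r_opt\<close> is strict before localization unless \<open>s = 0\<close>, which is why
  \<open>r = r_opt\<close> is allowed; for \<open>s = 0\<close> the cone degenerates to a point.\<close>

lemma reweighted_step:
  fixes G :: "real^'p \<Rightarrow> real^'p" and \<Sigma> :: "real^'p^'p" and \<beta>s bh bp w g :: "real^'p"
    and dq :: "real \<Rightarrow> real" and \<alpha> \<gamma> \<kappa> lam b c r :: real
  defines "S \<equiv> {j. \<beta>s $ j \<noteq> 0}" and "wt \<equiv> \<lambda>j. scaled_deriv dq lam \<bar>bp $ j\<bar>" and "d \<equiv> dq \<alpha>"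
  defines "s \<equiv> real (card S)"
  defines "r_opt \<equiv> sqrt \<gamma> * \<alpha> * c * sqrt s * lam"
    and "l \<equiv> ((2 + 2 / d) * sqrt (c\<^sup>2 + 1) + 2 / d) * sqrt (s / \<gamma>)"
  assumes norm: "\<And>u. sqrt \<gamma> * norm u \<le> norm_wrt \<Sigma> u"
    and mono: "\<And>a t v. a \<le> t \<Longrightarrow> G (\<beta>s + a *\<^sub>R v) \<bullet> v \<le> G (\<beta>s + t *\<^sub>R v) \<bullet> v"
    and opt: "G bh \<bullet> (bh - \<beta>s) \<le> (\<Sum>j\<in>UNIV. wt j * \<bar>\<beta>s $ j\<bar>) - (\<Sum>j\<in>UNIV. wt j * \<bar>bh $ j\<bar>)"
    and rsc: "\<And>\<beta>. norm_wrt \<Sigma> (\<beta> - \<beta>s) \<le> r \<Longrightarrow> norm1 (\<beta> - \<beta>s) \<le> l * norm_wrt \<Sigma> (\<beta> - \<beta>s) \<Longrightarrow>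
        \<kappa> * (norm_wrt \<Sigma> (\<beta> - \<beta>s))\<^sup>2 \<le> (G \<beta> - G \<beta>s) \<bullet> (\<beta> - \<beta>s)"
    and G: "G \<beta>s = w + g" and w: "\<And>j. \<bar>w $ j\<bar> \<le> d / 2 * lam"
    and g: "\<And>u. \<bar>g \<bullet> u\<bar> \<le> b * norm_wrt \<Sigma> u" and b: "0 \<le> b" "b \<le> sqrt (s / \<gamma>) * lam"
    and dq: "\<And>t. 0 \<le> t \<Longrightarrow> 0 \<le> dq t \<and> dq t \<le> 1" "\<And>t t'. 0 \<le> t' \<Longrightarrow> t' \<le> t \<Longrightarrow> dq t \<le> dq t'" "dq 0 = 1"
    and pos: "0 < \<gamma>" "0 < \<alpha>" "0 < d" "0 < lam" "0 < \<kappa>" "0 < c"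
    and c: "0.5 * d * sqrt (c\<^sup>2 + 1) + 2 = \<alpha> * \<kappa> * \<gamma> * c"
    and r: "r_opt \<le> r"
    and prev: "bp = 0 \<or> norm_wrt \<Sigma> (bp - \<beta>s) \<le> r_opt"
  shows "norm_wrt \<Sigma> (bh - \<beta>s) \<le> r_opt"
    and "\<kappa> * norm_wrt \<Sigma> (bh - \<beta>s) \<le> norm_wrt \<Sigma> (bp - \<beta>s) / (\<alpha> * \<gamma>)
      + (L2_set (\<lambda>j. scaled_deriv dq lam (max (\<bar>\<beta>s $ j\<bar> - \<alpha> * lam) 0)) S + L2_set (\<lambda>j. w $ j) S) / sqrt \<gamma> + b"
proof -
  define e where "e = bh - \<beta>s"
  define p where "p = bp - \<beta>s"
  define N where "N = norm_wrt \<Sigma> e"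
  define T where "T = S \<union> {j. wt j < d * lam}"
  define v where "v = (\<lambda>j. (if j \<in> S then wt j else 0) + \<bar>w $ j\<bar>)"
  define a where "a = (\<lambda>j. scaled_deriv dq lam (max (\<bar>\<beta>s $ j\<bar> - \<alpha> * lam) 0))"
  define R where "R = L2_set v T / sqrt \<gamma> + b"
  define \<phi> where "\<phi> = (\<lambda>u. (G (\<beta>s + u *\<^sub>R e) - G \<beta>s) \<bullet> e)"
  have nn: "0 \<le> norm_wrt \<Sigma> u" for u by (simp add: norm_wrt_def)
  have s0: "0 \<le> s" by (simp add: s_def)
  have wt: "0 \<le> wt j" "wt j \<le> lam" for j
    using dq(1)[of "\<bar>bp $ j\<bar> / lam"] pos by (auto simp: wt_def scaled_deriv_def)
  have T: "S \<subseteq> T" "finite T" "finite S" by (auto simp: T_def)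
  \<comment> \<open>Outside \<open>S\<close> the vectors \<open>p\<close> and \<open>bp\<close>
    agree, and since \<open>dq\<close> is non-increasing, a weight below \<open>d * lam\<close>
    forces \<open>bp $ j\<close> beyond \<open>\<alpha> * lam\<close>.\<close>
  have big: "\<alpha> * lam < \<bar>p $ j\<bar>" if "j \<in> T - S" for j
  proof (rule ccontr)
    assume "\<not> ?thesis"
    then have "\<bar>bp $ j\<bar> / lam \<le> \<alpha>" using that pos by (simp add: p_def S_def field_simps)
    then have "d \<le> dq (\<bar>bp $ j\<bar> / lam)" unfolding d_def using pos by (intro dq(2)) auto
    then have "d * lam \<le> wt j" using pos by (simp add: wt_def scaled_deriv_def)
    with that show False by (simp add: T_def)
  qed
  have "real (card (T - S)) \<le> c\<^sup>2 * s"
  \<comment> \<open>The zero start carries no bound on \<open>p\<close>, but there all weights equal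
    \<open>lam \<ge> d * lam\<close>, so \<open>T = S\<close>.\<close>
  proof (cases "bp = 0")
    case True
    have "d \<le> 1" using dq(1)[of \<alpha>] pos by (simp add: d_def)
    then have "T = S" using pos by (auto simp: T_def wt_def True scaled_deriv_def dq(3))
    then show ?thesis using s0 by simp
  next
    case False
    \<comment> \<open>Each index of \<open>T - S\<close> adds at least
      \<open>(\<alpha> * lam)\<^sup>2\<close> to \<open>(norm p)\<^sup>2\<close>. The factor
      \<open>sqrt \<gamma>\<close> in \<open>r_opt\<close> cancels against the eigenvalue bound,
      leaving \<open>c\<^sup>2 * s\<close>.\<close>
    have "real (card (T - S)) * (\<alpha> * lam)\<^sup>2 \<le> (norm p)\<^sup>2"
      using big pos by (intro card_thresholded_le) (auto intro: less_imp_le)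
    also have "sqrt \<gamma> * norm p \<le> sqrt \<gamma> * (\<alpha> * c * sqrt s * lam)"
      using norm[of p] prev False by (simp add: p_def r_opt_def mult_ac)
    then have "(norm p)\<^sup>2 \<le> (\<alpha> * c * sqrt s * lam)\<^sup>2" using pos by (intro power_mono) auto
    also have "\<dots> = c\<^sup>2 * s * (\<alpha> * lam)\<^sup>2" using s0 by (simp add: power_mult_distrib mult_ac)
    finally show ?thesis using pos by simp
  qed
  moreover have "card T = card S + card (T - S)" using T card_Diff_subset[of S T] card_mono[of T S] by simp
  ultimately have cardT: "real (card T) \<le> (c\<^sup>2 + 1) * s" by (simp add: s_def algebra_simps)

  have e: "\<beta>s + e = bh" by (simp add: e_def)
  have \<phi>1: "\<phi> 1 \<le> (\<Sum>j\<in>T. v j * \<bar>e $ j\<bar>) - d / 2 * lam * (\<Sum>j\<in>-T. \<bar>e $ j\<bar>) + b * N"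
    using penalized_error_ineq[where \<beta> = \<beta>s and e = e and T = T and wt = wt and \<eta> = "d / 2 * lam"
        and w = w and g = g and S = S and D = "G bh \<bullet> e" and B = "b * N"]
      T(1) wt(1) w opt g[of e]
    unfolding \<phi>_def v_def scaleR_one G inner_diff_left e by (auto simp: S_def T_def e_def N_def abs_le_iff)
  have \<phi>_mono: "\<phi> u \<le> \<phi> t" if "u \<le> t" for u t
    using mono[OF that, of e] by (simp add: \<phi>_def inner_diff_left)
  \<comment> \<open>Monotonicity alone suffices for the cone, so it holds before strong convexity
    may be used.\<close>
  have "0 \<le> \<phi> 1" using \<phi>_mono[of 0 1] by (simp add: \<phi>_def)
  then have cone: "norm1 e \<le> l * N"
    unfolding l_def using \<phi>1 wt(2) w pos nn[of e] s0 norm[of e] b(2) cardT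
    by (intro error_cone[where T = T and S = S and wt = wt and w = w and lam = lam and b = b]) (auto simp: v_def N_def)
  have LN: "L2_set (\<lambda>j. e $ j) T \<le> N / sqrt \<gamma>"
    using order_trans[OF L2_set_le_norm, of e "N / sqrt \<gamma>" T] norm[of e] pos by (simp add: N_def field_simps)
  have v0: "0 \<le> v j" for j using wt by (simp add: v_def)
  have "(\<Sum>j\<in>T. v j * \<bar>e $ j\<bar>) \<le> L2_set v T * L2_set (\<lambda>j. e $ j) T"
    using L2_set_mult_ineq[of v "\<lambda>j. e $ j" T] v0 by simp
  also have "\<dots> \<le> L2_set v T * (N / sqrt \<gamma>)" by (intro mult_left_mono LN) simp
  finally have le: "(\<Sum>j\<in>T. v j * \<bar>e $ j\<bar>) \<le> L2_set v T * (N / sqrt \<gamma>)" .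
  have "0 \<le> d / 2 * lam * (\<Sum>j\<in>-T. \<bar>e $ j\<bar>)" using pos by (simp add: sum_nonneg)
  with \<phi>1 le have "\<phi> 1 \<le> L2_set v T * (N / sqrt \<gamma>) + b * N" by linarith
  then have upper: "\<phi> 1 \<le> R * N" by (simp add: R_def algebra_simps)
  have R0: "0 \<le> R" using pos b by (simp add: R_def)
  have main: "N \<le> r_opt \<and> \<kappa> * N \<le> R"
  proof (cases "card S = 0")
    case True
    then have "norm1 e \<le> 0" using cone by (simp add: l_def s_def)
    then have "e $ j = 0" for j
      using member_le_sum[of j UNIV "\<lambda>j. \<bar>e $ j\<bar>"] by (simp add: norm1_def)
    then have "e = 0" by (simp add: vec_eq_iff)
    then show ?thesis using R0 True by (simp add: N_def norm_wrt_def r_opt_def s_def)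
  next
    case False
    have "L2_set v T < (1 + d / 2 * sqrt (c\<^sup>2 + 1)) * sqrt s * lam"
      unfolding v_def s_def using T wt w pos False cardT
      by (intro weight_L2_crude) (auto simp: s_def)
    then have "R < (1 + d / 2 * sqrt (c\<^sup>2 + 1)) * sqrt s * lam / sqrt \<gamma> + sqrt (s / \<gamma>) * lam"
      unfolding R_def using pos b by (intro add_less_le_mono divide_strict_right_mono) auto
    \<comment> \<open>The 2 collects one unit from the weights on \<open>S\<close> and one from the
      bias; the equation for \<open>c\<close> then turns the sum into
      \<open>\<kappa> * r_opt\<close>.\<close>
    also have "\<dots> = (0.5 * d * sqrt (c\<^sup>2 + 1) + 2) * (sqrt s * lam / sqrt \<gamma>)"
      by (simp add: real_sqrt_divide algebra_simps add_divide_distrib)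
    also have "\<dots> = \<kappa> * r_opt"
      unfolding c r_opt_def using pos by (simp add: field_simps)
    finally have R: "R < \<kappa> * r_opt" .
    have "\<kappa> * N \<le> R"
    proof (rule localization[where \<phi> = \<phi> and r = r])
      show "\<kappa> * (u * N)\<^sup>2 \<le> u * \<phi> u" if "0 \<le> u" "u \<le> 1" "u * N \<le> r" for u
      proof -
        \<comment> \<open>The cone condition is homogeneous, so it passes from \<open>e\<close> to
          the shrunken error.\<close>
        have "norm1 (u *\<^sub>R e) = u * norm1 e" using that by (simp add: norm1_def abs_mult sum_distrib_left)
        moreover have "norm_wrt \<Sigma> (u *\<^sub>R e) = u * N" using that by (simp add: norm_wrt_scaleR N_def)
        ultimately show ?thesis
          using rsc[of "\<beta>s + u *\<^sub>R e"] that mult_left_mono[OF cone that(1)] by (simp add: \<phi>_def mult_ac)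
      qed
      show "R < \<kappa> * r" using R mult_left_mono[OF r less_imp_le[OF pos(5)]] by linarith
    qed (use \<phi>_mono upper R0 pos nn[of e] in \<open>auto simp: N_def\<close>)
    with R pos show ?thesis by (smt (verit) mult_less_cancel_left_pos)
  qed
  then show "norm_wrt \<Sigma> (bh - \<beta>s) \<le> r_opt" by (simp add: N_def e_def)

  have "L2_set v T \<le> L2_set a S + L2_set (\<lambda>j. w $ j) S + norm p / \<alpha>"
    unfolding v_def
  proof (rule weight_L2_refined[OF T(1) pos(2)])
    fix j assume j: "j \<in> S"
    show "0 \<le> wt j" by (rule wt)
    show "wt j \<le> a j + \<bar>p $ j\<bar> / \<alpha>"
    \<comment> \<open>Either \<open>p $ j\<close> is so large that
      \<open>\<bar>p $ j\<bar> / \<alpha>\<close> exceeds the maximal weight \<open>lam\<close>, or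
      \<open>bp $ j\<close> is close enough to the true coefficient for monotonicity of
      \<open>dq\<close> to give \<open>a j\<close>.\<close>
    proof (cases "\<alpha> * lam \<le> \<bar>p $ j\<bar>")
      case True
      then have "lam \<le> \<bar>p $ j\<bar> / \<alpha>" using pos by (simp add: field_simps)
      moreover have "0 \<le> a j" using dq(1) pos by (simp add: a_def scaled_deriv_def)
      ultimately show ?thesis using wt(2)[of j] by simp
    next
      case False
      then have "max (\<bar>\<beta>s $ j\<bar> - \<alpha> * lam) 0 \<le> \<bar>bp $ j\<bar>" by (auto simp: p_def)
      then have "wt j \<le> a j"
        unfolding wt_def a_def scaled_deriv_def using pos
        by (intro mult_left_mono dq(2)) (auto simp: divide_right_mono)
      then show ?thesis using pos by (simp add: add_increasing2)
    qed
  next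
    fix j assume "j \<in> T - S"
    from big[OF this] have "lam \<le> \<bar>p $ j\<bar> / \<alpha>" using pos by (simp add: field_simps)
    moreover have "d / 2 * lam \<le> lam" using dq(1)[of \<alpha>] pos by (simp add: d_def)
    ultimately show "\<bar>w $ j\<bar> \<le> \<bar>p $ j\<bar> / \<alpha>" using w[of j] by linarith
  qed
  also have "norm p / \<alpha> \<le> norm_wrt \<Sigma> p / sqrt \<gamma> / \<alpha>"
    using norm[of p] pos by (intro divide_right_mono) (auto simp: field_simps)
  finally have "L2_set v T / sqrt \<gamma>
      \<le> (L2_set a S + L2_set (\<lambda>j. w $ j) S + norm_wrt \<Sigma> p / sqrt \<gamma> / \<alpha>) / sqrt \<gamma>"
    using pos by (intro divide_right_mono) auto
  also have "\<dots> = norm_wrt \<Sigma> p / (\<alpha> * \<gamma>) + (L2_set a S + L2_set (\<lambda>j. w $ j) S) / sqrt \<gamma>"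
    using pos by (simp add: add_divide_distrib mult_ac)
  finally show "\<kappa> * norm_wrt \<Sigma> (bh - \<beta>s) \<le> norm_wrt \<Sigma> (bp - \<beta>s) / (\<alpha> * \<gamma>)
      + (L2_set (\<lambda>j. scaled_deriv dq lam (max (\<bar>\<beta>s $ j\<bar> - \<alpha> * lam) 0)) S + L2_set (\<lambda>j. w $ j) S) / sqrt \<gamma> + b"
    using main by (simp add: R_def N_def e_def p_def a_def)
qed

section \<open>Iterating the bounds for a single program\<close>

theorem theorem4p2:
  fixes M :: "'a measure" and one :: "'p::finite" and \<beta>s :: "real^'p"
    and x :: "'a \<Rightarrow> real^'p" and y eps :: "'a \<Rightarrow> real"
    and n :: nat and X :: "nat \<Rightarrow> 'a \<Rightarrow> real^'p" and Y :: "nat \<Rightarrow> 'a \<Rightarrow> real"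
    and K q dq :: "real \<Rightarrow> real"
    and \<tau> h \<kappa> \<alpha>0 lam r :: real
    and \<omega> :: 'a and bhat :: "nat \<Rightarrow> real^'p"
  defines "\<Sigma> \<equiv> second_moment M x"
  defines "\<gamma> \<equiv> min_eigenvalue \<Sigma>"
    and "S \<equiv> {j. \<beta>s $ j \<noteq> 0}"
  defines "s \<equiv> real (card S)"
  defines "Qhat \<equiv> (\<lambda>\<omega>. emp_loss \<tau> K h n (\<lambda>i. X i \<omega>) (\<lambda>i. Y i \<omega>))"
  defines "Q \<equiv> (\<lambda>\<beta>. \<integral>\<omega>. Qhat \<omega> \<beta> \<partial>M)"
  defines "w \<equiv> (\<lambda>\<omega>. gradient (Qhat \<omega>) \<beta>s - gradient Q \<beta>s)"
    and "b \<equiv> norm (matrix_inv (matrix_sqrt \<Sigma>) *v gradient Q \<beta>s)"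
  defines "c \<equiv> (THE c. 0 < c \<and> 0.5 * dq \<alpha>0 * sqrt (c\<^sup>2 + 1) + 2 = \<alpha>0 * \<kappa> * \<gamma> * c)"
  defines "r_opt \<equiv> sqrt \<gamma> * \<alpha>0 * c * sqrt s * lam"
    and "l \<equiv> ((2 + 2 / dq \<alpha>0) * sqrt (c\<^sup>2 + 1) + 2 / dq \<alpha>0) * sqrt (s / \<gamma>)"
    and "\<delta> \<equiv> sqrt (1 + (dq \<alpha>0 / 2)\<^sup>2) / (\<alpha>0 * \<kappa> * \<gamma>)"
    and "r_ora \<equiv> (L2_set (\<lambda>j. scaled_deriv dq lam (max (\<bar>\<beta>s $ j\<bar> - \<alpha>0 * lam) 0)) S
                    + L2_set (\<lambda>j. w \<omega> $ j) S) / (\<kappa> * sqrt \<gamma>)"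
  assumes model: "quantile_model M \<tau> one \<beta>s x y eps n X Y"
    and \<Sigma>: "pos_def \<Sigma>" and \<gamma>: "0 < \<gamma>" "\<gamma> \<le> 1"
    and K: "smoothing_kernel K" and h: "0 < h" and finite_loss: "smoothed_loss_finite \<tau> K h"
    and \<kappa>: "0 < \<kappa>"
    and pen: "concave_penalty q dq"
    and \<alpha>0: "0 < \<alpha>0" "\<alpha>0 / sqrt (1 + (dq \<alpha>0 / 2)\<^sup>2) > 1 / (\<kappa> * \<gamma>)" "0 < dq \<alpha>0"
    and lam: "0 < lam" and bias: "b \<le> sqrt (s / \<gamma>) * lam"
    and r: "r_opt \<le> r"
    and event: "\<omega> \<in> rsc_event M Qhat \<Sigma> \<beta>s r l \<kappa> \<inter> {\<omega> \<in> space M. infnorm (w \<omega>) \<le> 0.5 * dq \<alpha>0 * lam}"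
    and iter: "reweighted_iterates (Qhat \<omega>) dq lam bhat"
  shows "0 < \<delta> \<and> \<delta> < 1 \<and>
    (\<forall>m\<ge>1. norm_wrt \<Sigma> (bhat m - \<beta>s) \<le> \<delta> * norm_wrt \<Sigma> (bhat (m - 1) - \<beta>s) + r_ora + b / \<kappa>) \<and>
    (\<forall>m\<ge>2. norm_wrt \<Sigma> (bhat m - \<beta>s) \<le> \<delta> ^ (m - 1) * r_opt + (r_ora + b / \<kappa>) / (1 - \<delta>))"
proof -
  define d where "d = dq \<alpha>0"
  define N where "N = norm_wrt \<Sigma>"
  define g where "g = gradient Q \<beta>s"
  define G where "G = gradient (Qhat \<omega>)"
  have loss: "0 < \<tau>" "\<tau> < 1" using model by (auto simp: quantile_model_def)
  note loss = loss h K finite_loss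
  have dq: "0 \<le> t \<Longrightarrow> 0 \<le> dq t \<and> dq t \<le> 1" "0 \<le> t' \<Longrightarrow> t' \<le> t \<Longrightarrow> dq t \<le> dq t'" "dq 0 = 1" for t t'
    using pen by (auto simp: concave_penalty_def)
  note psd = pos_def_imp_pos_semidef[OF \<Sigma>]
  have norm: "sqrt \<gamma> * norm u \<le> norm_wrt \<Sigma> u" for u
    using min_eigenvalue_norm_le[OF psd] \<gamma> by (simp add: \<gamma>_def)
  have sq1: "1 \<le> sqrt (1 + (d / 2)\<^sup>2)" and sqd: "d / 2 < sqrt (1 + (d / 2)\<^sup>2)"
    by (simp, rule real_less_rsqrt, simp)
  have A: "sqrt (1 + (d / 2)\<^sup>2) < \<alpha>0 * \<kappa> * \<gamma>"
    using \<alpha>0(2) \<kappa> \<gamma> less_le_trans[OF zero_less_one sq1] by (simp add: d_def field_simps)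
  then have A0: "0 < \<alpha>0 * \<kappa> * \<gamma>" using sq1 by linarith
  \<comment> \<open>The third fact passes from the factor that \<open>reweighted_step\<close> yields
    to the larger \<open>\<delta>\<close>.\<close>
  have \<delta>: "0 < \<delta>" "\<delta> < 1" "1 / (\<alpha>0 * \<kappa> * \<gamma>) \<le> \<delta>"
    unfolding \<delta>_def d_def[symmetric]
    subgoal using A0 sq1 by (intro divide_pos_pos) linarith+
    subgoal using A A0 by (simp only: divide_less_eq_1_pos)
    subgoal using A0 sq1 by (intro divide_right_mono) linarith+
    done
  \<comment> \<open>\<open>c\<close> is a definite description, so its equation needs existence and
    uniqueness first; \<open>sqd\<close> and \<open>A\<close> supply the slope condition of
    \<open>ex1_radius\<close>.\<close>
  have c: "0 < c \<and> 0.5 * dq \<alpha>0 * sqrt (c\<^sup>2 + 1) + 2 = \<alpha>0 * \<kappa> * \<gamma> * c"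
    unfolding c_def by (rule theI', rule ex1_radius) (use A sqd \<alpha>0 in \<open>auto simp: d_def\<close>)
  have b0: "0 \<le> b" by (simp add: b_def)
  have e0: "0 \<le> r_ora + b / \<kappa>" using b0 \<kappa> \<gamma> by (simp add: r_ora_def)
  have rsc: "\<kappa> * (norm_wrt \<Sigma> (\<beta> - \<beta>s))\<^sup>2 \<le> (G \<beta> - G \<beta>s) \<bullet> (\<beta> - \<beta>s)"
    if "norm_wrt \<Sigma> (\<beta> - \<beta>s) \<le> r" "norm1 (\<beta> - \<beta>s) \<le> l * norm_wrt \<Sigma> (\<beta> - \<beta>s)" for \<beta>
    using event that by (auto simp: rsc_event_def G_def)
  have w: "\<bar>w \<omega> $ j\<bar> \<le> dq \<alpha>0 / 2 * lam" for j
    using event component_le_infnorm_cart[of "w \<omega>" j] by auto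
  have mono: "G (\<beta>s + a *\<^sub>R v) \<bullet> v \<le> G (\<beta>s + t *\<^sub>R v) \<bullet> v" if "a \<le> t" for a t v
    unfolding G_def Qhat_def using gradient_emp_loss_line_mono[OF loss that] by blast
  have gu: "\<bar>g \<bullet> u\<bar> \<le> b * norm_wrt \<Sigma> u" for u
    using inner_le_dual_norm_wrt[OF \<Sigma>] by (simp add: b_def g_def)
  have iterate: "N (bhat m - \<beta>s) \<le> r_opt \<and>
      N (bhat m - \<beta>s) \<le> \<delta> * N (bhat (m - 1) - \<beta>s) + r_ora + b / \<kappa>"
    if m: "1 \<le> m" and prev: "bhat (m - 1) = 0 \<or> N (bhat (m - 1) - \<beta>s) \<le> r_opt" for m
  proof -
    define wt where "wt = (\<lambda>j. scaled_deriv dq lam \<bar>bhat (m - 1) $ j\<bar>)"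
    define P where "P = (\<lambda>\<beta>::real^'p. \<Sum>j\<in>UNIV. wt j * \<bar>\<beta> $ j\<bar>)"
    have "0 \<le> wt j" for j using dq(1) lam by (simp add: wt_def scaled_deriv_def)
    then have "convex_on UNIV P" unfolding P_def by (rule convex_on_weighted_l1)
    moreover have "Qhat \<omega> (bhat m) + P (bhat m) \<le> Qhat \<omega> z + P z" for z
      using iter m by (auto simp: reweighted_iterates_def is_arg_min_linorder P_def wt_def)
    \<comment> \<open>The minimizer is tested in the direction of the true parameter.\<close>
    moreover have "((\<lambda>t. Qhat \<omega> (bhat m + t *\<^sub>R (\<beta>s - bhat m))) has_real_derivative
        G (bhat m) \<bullet> (\<beta>s - bhat m)) (at 0)"
      unfolding Qhat_def G_def using emp_loss_line_deriv[OF loss, where t = 0] by simp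
    ultimately have "0 \<le> G (bhat m) \<bullet> (\<beta>s - bhat m) + (P (bhat m + (\<beta>s - bhat m)) - P (bhat m))"
      by (intro minimizer_variational_ineq)
    then have opt: "G (bhat m) \<bullet> (bhat m - \<beta>s) \<le> P \<beta>s - P (bhat m)"
      by (simp add: inner_diff_right)
    have Gb: "G \<beta>s = w \<omega> + g" by (simp add: G_def g_def w_def)
    note st = reweighted_step[where G = G and \<Sigma> = \<Sigma> and \<beta>s = \<beta>s and bh = "bhat m" and bp = "bhat (m - 1)"
        and w = "w \<omega>" and g = g and \<gamma> = \<gamma> and dq = dq and lam = lam and \<alpha> = \<alpha>0 and c = c and r = r
        and \<kappa> = \<kappa> and b = b, folded S_def, folded s_def, folded r_opt_def l_def, OF norm mono
        opt[unfolded P_def wt_def] rsc Gb w gu b0 bias dq \<gamma>(1) \<alpha>0(1) \<alpha>0(3) lam \<kappa> conjunct1[OF c]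
        conjunct2[OF c] r prev[unfolded N_def]]
    let ?Np = "norm_wrt \<Sigma> (bhat (m - 1) - \<beta>s)"
    have "norm_wrt \<Sigma> (bhat m - \<beta>s) \<le> (?Np / (\<alpha>0 * \<gamma>) + \<kappa> * r_ora + b) / \<kappa>"
      using st(2) \<kappa> \<gamma> by (simp add: r_ora_def pos_le_divide_eq mult.commute[of _ \<kappa>])
    also have "\<dots> = 1 / (\<alpha>0 * \<kappa> * \<gamma>) * ?Np + r_ora + b / \<kappa>"
      using \<kappa> by (simp add: add_divide_distrib mult_ac)
    also have "\<dots> \<le> \<delta> * ?Np + r_ora + b / \<kappa>"
      using \<delta>(3) by (intro add_right_mono mult_right_mono) (auto simp: norm_wrt_def)
    finally show ?thesis using st(1) by (simp add: N_def)
  qed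
  have init: "bhat 0 = 0" using iter by (simp add: reweighted_iterates_def)
  \<comment> \<open>The induction begins at 1 through the alternative
    \<open>bhat (m - 1) = 0\<close>; afterwards each iterate supplies the radius bound for the
    next.\<close>
  have bound: "N (bhat m - \<beta>s) \<le> r_opt" if "1 \<le> m" for m
    using that
  proof (induction m rule: dec_induct)
    case base
    then show ?case using iterate[of 1] init by simp
  next
    case (step m)
    then show ?case using iterate[of "Suc m"] by simp
  qed
  have contr: "N (bhat m - \<beta>s) \<le> \<delta> * N (bhat (m - 1) - \<beta>s) + r_ora + b / \<kappa>" if "1 \<le> m" for m
    using iterate[OF that] bound[of "m - 1"] init that by (cases "m = 1") auto
  have "N (bhat m - \<beta>s) \<le> \<delta> ^ (m - 1) * r_opt + (r_ora + b / \<kappa>) / (1 - \<delta>)" if "2 \<le> m" for m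
    using that contr bound[of 1] \<delta> e0
    by (intro contraction_iterate[where a = "\<lambda>m. N (bhat m - \<beta>s)"]) (auto simp: add.assoc)
  with \<delta> contr show ?thesis by (simp add: N_def)
qed

end
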